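(* Let $n\ge 1$ and let $w\in W_n$. Then $w\in W_b$ if and only if $Sh(w)$ is a Young diagram with at most two rows. In other words, the domino insertion bijection $w\mapsto (P(w),Q(w))$ restricts to a bijection from $W_b$ onto the set of pairs $(S,T)$ of standard domino tableaux with $n$ dominoes having the same shape, this shape having at most two rows.
   Context: $W_n$ is the Coxeter group of type $B_n$: the group of permutations $w$ of $I_n=\{\pm1,\dots,\pm n\}$ with $w(-i)=-w(i)$, generated by $s_0=(-1,1)$ and $s_i=(i,i+1)(-i,-i-1)$, $1\le i\le n-1$ (products composed from right to left). The word form of $w$ is $w=i_1i_2\cdots i_n$ with $i_k=w(k)$. $W_b\subseteq W_n$ is the set of those $w$ such that no reduced expression of $w$ in $s_0,\dots,s_{n-1}$ contains three consecutive factors of the form $s_is_js_i$ with $i\in\{1,\dots,n-1\}$, $j\in\{0,\dots,n-1\}$, $|i-j|=1$ (so $s_1s_0s_1$ is forbidden, $s_0s_1s_0$ is allowed). A standard domino tableau with $n$ dominoes is a tiling of the Young diagram of a partition of $2n$ by dominoes (pairs of horizontally or vertically adjacent cells), labelled bijectively by $1,\dots,n$, with labels weakly increasing along rows (left to right) and columns (top to bottom); its shape is the underlying partition. Domino insertion (empty core, $r=0$): start with the empty tableau and insert $i_1,i_2,\dots,i_n$ successively. To insert a signed letter $x$ (with $|x|$ not a label of $T$) into a domino tableau $T$ with distinct labels: take the subtableau of dominoes with labels $<|x|$; if $x>0$ add a horizontal domino labelled $|x|$ at the end of the first row, if $x<0$ add a vertical domino labelled $|x|$ at the bottom of the first column.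 Then treat the dominoes $d$ of $T$ with labels $j>|x|$ in increasing order of $j$; with $\mu$ the shape of the tableau built so far: (1) if $d\cap\mu=\emptyset$, add $d$ unchanged; (2) if $d\cap\mu$ is a single cell $(k,l)$, add a domino labelled $j$ occupying the two cells of $(d\cup\{(k+1,l+1)\})\setminus\mu$; (3) if $d\subset\mu$ is horizontal in row $k$, add a horizontal domino labelled $j$ at the end of row $k+1$; (4) if $d\subset\mu$ is vertical in column $l$, add a vertical domino labelled $j$ at the bottom of column $l+1$. The final tableau is $P(w)$; $Q(w)$ is the recording tableau, whose domino labelled $k$ is the difference of the shapes after and before the $k$-th insertion. The map $w\mapsto(P(w),Q(w))$ is a bijection from $W_n$ to pairs of standard domino tableaux with $n$ dominoes of equal shape, and $Sh(w)$ denotes the common shape of $P(w)$ and $Q(w)$. *)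

theory Defs
  imports Main "HOL-Combinatorics.Permutations"
begin

definition I_set :: "nat \<Rightarrow> int set" where
  "I_set n = {- int n..int n} - {0}"

definition W :: "nat \<Rightarrow> (int \<Rightarrow> int) set" where
  "W n = {w. w permutes I_set n \<and> (\<forall>i\<in>I_set n. w (- i) = - w i)}"

definition gen :: "nat \<Rightarrow> int \<Rightarrow> int" where
  "gen i = (if i = 0 then transpose (-1) 1
     else transpose (int i) (int i + 1) \<circ> transpose (- int i) (- int i - 1))"

definition word_prod :: "nat list \<Rightarrow> int \<Rightarrow> int" where
  "word_prod as = foldr (\<lambda>a f. gen a \<circ> f) as id"

definition expression_of :: "nat \<Rightarrow> (int \<Rightarrow> int) \<Rightarrow> nat list \<Rightarrow> bool" where
  "expression_of n w as \<longleftrightarrow> set as \<subseteq> {0..<n} \<and> word_prod as = w"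

definition reduced_expression_of :: "nat \<Rightarrow> (int \<Rightarrow> int) \<Rightarrow> nat list \<Rightarrow> bool" where
  "reduced_expression_of n w as \<longleftrightarrow>
     expression_of n w as \<and> (\<forall>bs. expression_of n w bs \<longrightarrow> length as \<le> length bs)"

definition W_b :: "nat \<Rightarrow> (int \<Rightarrow> int) set" where
  "W_b n = {w \<in> W n. \<forall>as. reduced_expression_of n w as \<longrightarrow>
     \<not> (\<exists>us vs i j. as = us @ [i, j, i] @ vs \<and>
          i \<in> {1..<n} \<and> j \<in> {0..<n} \<and> \<bar>int i - int j\<bar> = 1)}"

text \<open>Cells are pairs (row, column), both counted from 1. All parts of a partition are positive,
  so the number of rows of the Young diagram of \<open>p\<close> is \<open>length p\<close>.\<close>

type_synonym cell = "nat \<times> nat"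

definition is_partition :: "nat list \<Rightarrow> bool" where
  "is_partition p \<longleftrightarrow> sorted_wrt (\<ge>) p \<and> 0 \<notin> set p"

definition young_diagram :: "nat list \<Rightarrow> cell set" where
  "young_diagram p = {(k, l). 1 \<le> k \<and> k \<le> length p \<and> 1 \<le> l \<and> l \<le> p ! (k - 1)}"

definition hdomino :: "nat \<Rightarrow> nat \<Rightarrow> cell set" where
  "hdomino k l = {(k, l), (k, l + 1)}"

definition vdomino :: "nat \<Rightarrow> nat \<Rightarrow> cell set" where
  "vdomino k l = {(k, l), (k + 1, l)}"

definition is_domino :: "cell set \<Rightarrow> bool" where
  "is_domino d \<longleftrightarrow> (\<exists>k l. d = hdomino k l \<or> d = vdomino k l)"

text \<open>A tableau maps each label in use to the domino carrying it. Its shape is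
  represented by the set of cells covered.\<close>

type_synonym tableau = "nat \<rightharpoonup> cell set"

definition shape :: "tableau \<Rightarrow> cell set" where
  "shape T = \<Union> (ran T)"

definition standard_domino_tableau :: "nat \<Rightarrow> tableau \<Rightarrow> bool" where
  "standard_domino_tableau n T \<longleftrightarrow>
     dom T = {1..n} \<and>
     (\<forall>d\<in>ran T. is_domino d) \<and>
     (\<forall>i\<in>dom T. \<forall>j\<in>dom T. i \<noteq> j \<longrightarrow> the (T i) \<inter> the (T j) = {}) \<and>
     (\<exists>p. is_partition p \<and> sum_list p = 2 * n \<and> shape T = young_diagram p) \<and>
     (\<forall>i\<in>dom T. \<forall>j\<in>dom T. \<forall>k l l'.
        (k, l) \<in> the (T i) \<and> (k, l') \<in> the (T j) \<and> l \<le> l' \<longrightarrow> i \<le> j) \<and>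
     (\<forall>i\<in>dom T. \<forall>j\<in>dom T. \<forall>k k' l.
        (k, l) \<in> the (T i) \<and> (k', l) \<in> the (T j) \<and> k \<le> k' \<longrightarrow> i \<le> j)"

definition at_most_two_rows :: "cell set \<Rightarrow> bool" where
  "at_most_two_rows D \<longleftrightarrow> (\<exists>p. is_partition p \<and> length p \<le> 2 \<and> D = young_diagram p)"

definition row_end :: "cell set \<Rightarrow> nat \<Rightarrow> cell set" where
  "row_end \<mu> k = hdomino k (card {l. (k, l) \<in> \<mu>} + 1)"

definition column_end :: "cell set \<Rightarrow> nat \<Rightarrow> cell set" where
  "column_end \<mu> l = vdomino (card {k. (k, l) \<in> \<mu>} + 1) l"

text \<open>\<open>bump \<mu> d\<close> is the new position of the domino \<open>d\<close> when the dominoes placed so far have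
  shape \<open>\<mu>\<close>. In the last two cases \<open>d\<close> is contained in \<open>\<mu>\<close>, and \<open>Min\<close> extracts the common
  row (resp. column) of the two cells of \<open>d\<close>.\<close>

definition bump :: "cell set \<Rightarrow> cell set \<Rightarrow> cell set" where
  "bump \<mu> d =
     (if d \<inter> \<mu> = {} then d
      else if is_singleton (d \<inter> \<mu>) then
        (case the_elem (d \<inter> \<mu>) of (k, l) \<Rightarrow> insert (k + 1, l + 1) d - \<mu>)
      else if \<exists>k l. d = hdomino k l then row_end \<mu> (Min (fst ` d) + 1)
      else column_end \<mu> (Min (snd ` d) + 1))"

definition place :: "tableau \<Rightarrow> nat \<Rightarrow> cell set \<Rightarrow> tableau" where
  "place S j d = S(j \<mapsto> bump (shape S) d)"

definition domino_insert :: "tableau \<Rightarrow> int \<Rightarrow> tableau" where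
  "domino_insert T x =
     (let a = nat \<bar>x\<bar>;
          T\<^sub>0 = T |` {..<a};
          T\<^sub>1 = T\<^sub>0(a \<mapsto> (if x > 0 then row_end (shape T\<^sub>0) 1 else column_end (shape T\<^sub>0) 1))
      in foldl (\<lambda>S j. place S j (the (T j))) T\<^sub>1 (sorted_list_of_set {j \<in> dom T. a < j}))"

definition insert_prefix :: "(int \<Rightarrow> int) \<Rightarrow> nat \<Rightarrow> tableau" where
  "insert_prefix w k = foldl domino_insert Map.empty (map (\<lambda>i. w (int i)) [1..<k + 1])"

definition P_tab :: "nat \<Rightarrow> (int \<Rightarrow> int) \<Rightarrow> tableau" where
  "P_tab n w = insert_prefix w n"

definition Q_tab :: "nat \<Rightarrow> (int \<Rightarrow> int) \<Rightarrow> tableau" where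
  "Q_tab n w = (\<lambda>k. if k \<in> {1..n}
     then Some (shape (insert_prefix w k) - shape (insert_prefix w (k - 1))) else None)"

definition Sh :: "nat \<Rightarrow> (int \<Rightarrow> int) \<Rightarrow> cell set" where
  "Sh n w = shape (P_tab n w)"

end

theory Submission
  imports Defs
begin

text \<open>
  Both conditions on \<open>w\<close> say that the word \<open>w(-n)\<dots>w(-1)w(1)\<dots>w(n)\<close> has no decreasing subsequence
  of length three. On the Coxeter side, ascents preserve such a subsequence, a factor \<open>s\<^sub>is\<^sub>js\<^sub>i\<close>
  of a reduced expression creates one, and if every descent
  destroys all of them, then one of them occupies adjacent positions and \<open>w\<close> has a reduced expression ending in a
  braid.

  On the tableau side, a domino tableau with at most two rows is the same as a word in two letters U and D
  on its labels: U is a domino in the first row, D a horizontal domino in the second row or, if both rows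
  have equal length, a vertical domino. Inserting \<open>x\<close> stays within two rows if and only if the labels
  larger than \<open>\<bar>x\<bar>\<close> spell \<open>D\<dots>DU\<dots>U\<close> and, for negative \<open>x\<close>, there are no smaller labels. The effect of
  the insertion is to add the label \<open>\<bar>x\<bar>\<close> with letter U or D according to the sign of \<open>x\<close>, and to turn the
  next U after it into D. The cells outside two rows never disappear again. The
  difference of the row lengths decreases if and only if a U is turned into D, so the recording tableau
  tells how to undo the insertion.
\<close>

section \<open>Coxeter length and reduced expressions\<close>

text \<open>Because of the antisymmetry of the full word, a decreasing triple can be described on
  positive positions alone, with a sign kept at a single entry. In full words of rank two, the
  forbidden braid gives 2, -1, 1, -2 with the triple 2, 1, -2, while the allowed
  \<open>s\<^sub>0s\<^sub>1s\<^sub>0\<close> gives 1, 2, -2, -1 without any. The link between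
  patterns and insertion is a U at a label \<open>a\<close> below a D. It records that some letter
  of value at least \<open>a\<close> follows one of larger absolute value, and it can never be
  repaired. A later letter of absolute value below \<open>a\<close> therefore completes a pattern
  and, for the same reason, forces a third row. An insertion can be undone only if the level before
  it is known: U at 1 and D at 2 arise by inserting 1 either into a D at 2 (level 0) or into a U at
  2 (level 1). Once it is known whether a U was flipped, decoding is unambiguous. A flipped letter
  is the last D; the inserted letter is the last U of what precedes it (of the whole word if nothing
  was flipped), or the first letter if there is no U.\<close>

lemma W_minus: "w \<in> W n \<Longrightarrow> w (- i) = - w i"
  by (cases "i \<in> I_set n") (auto simp: W_def I_set_def permutes_def)

lemma W_inj: "w \<in> W n \<Longrightarrow> inj w"
  by (auto simp: W_def permutes_inj)

lemma W_eq_iff: "w \<in> W n \<Longrightarrow> w p = w q \<longleftrightarrow> p = q"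
  using W_inj[of w n] by (auto simp: inj_def)

lemma W_zero: "w \<in> W n \<Longrightarrow> w 0 = 0"
  by (auto simp: W_def I_set_def permutes_def)

lemma W_nonzero: "w \<in> W n \<Longrightarrow> p \<noteq> 0 \<Longrightarrow> w p \<noteq> 0"
  using W_eq_iff[of w n p 0] W_zero[of w n] by simp

lemma W_in_I_set: "w \<in> W n \<Longrightarrow> w p \<in> I_set n \<longleftrightarrow> p \<in> I_set n"
  by (auto simp: W_def permutes_in_image)

lemma W_abs_eq_iff: "w \<in> W n \<Longrightarrow> \<bar>w p\<bar> = \<bar>w q\<bar> \<longleftrightarrow> \<bar>p\<bar> = \<bar>q\<bar>"
  using W_eq_iff[of w n p q] W_eq_iff[of w n p "- q"] W_minus[of w n q] by (auto simp: abs_eq_iff)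

lemma id_in_W: "id \<in> W n"
  by (auto simp: W_def permutes_id)

lemma comp_in_W: "v \<in> W n \<Longrightarrow> w \<in> W n \<Longrightarrow> v \<circ> w \<in> W n"
  unfolding W_def by (auto intro: permutes_compose simp: permutes_in_image)

lemma gen_zero: "gen 0 p = (if p = 1 then - 1 else if p = - 1 then 1 else p)"
  by (simp add: gen_def transpose_def)

lemma gen_pos:
  "i > 0 \<Longrightarrow> gen i p = (if p = int i then int i + 1 else if p = int i + 1 then int i
    else if p = - int i then - int i - 1 else if p = - int i - 1 then - int i else p)"
  by (simp add: gen_def transpose_def)

lemma gen_gen: "gen i (gen i p) = p"
  by (cases "i = 0") (auto simp: gen_zero gen_pos)

lemma gen_comp_gen: "w \<circ> gen i \<circ> gen i = w"
  by (simp add: fun_eq_iff gen_gen)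

lemma gen_in_W:
  assumes "i < n" shows "gen i \<in> W n"
proof -
  have "gen i permutes I_set n"
  proof (rule bij_imp_permutes)
    have "gen i p \<in> I_set n" if "p \<in> I_set n" for p
      using that assms by (cases "i = 0") (auto simp: gen_zero gen_pos I_set_def)
    then show "bij_betw (gen i) (I_set n) (I_set n)"
      by (intro bij_betwI[of _ _ _ "gen i"]) (auto simp: gen_gen)
    show "gen i p = p" if "p \<notin> I_set n" for p
      using that assms by (cases "i = 0") (auto simp: gen_zero gen_pos I_set_def)
  qed
  then show ?thesis
    by (cases "i = 0") (auto simp: W_def gen_zero gen_pos)
qed

text \<open>Since \<open>w (- 1) = - w 1\<close>, the case \<open>i = 0\<close> means
  \<open>w (- 1) < w 1\<close>: in every case the neighbouring entries of the full word that
  \<open>gen i\<close> exchanges are increasing.\<close>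

definition ascent :: "(int \<Rightarrow> int) \<Rightarrow> nat \<Rightarrow> bool" where
  "ascent w i \<longleftrightarrow> (if i = 0 then 0 < w 1 else w (int i) < w (int i + 1))"

lemma not_ascent_gen:
  assumes "w \<in> W n" "\<not> ascent w i" shows "ascent (w \<circ> gen i) i"
proof (cases "i = 0")
  case True
  then show ?thesis using assms W_nonzero[OF assms(1), of 1] W_minus[OF assms(1), of 1]
    by (auto simp: ascent_def gen_zero)
next
  case False
  then show ?thesis using assms W_eq_iff[OF assms(1), of "int i" "int i + 1"]
    by (auto simp: ascent_def gen_pos)
qed

section \<open>Length as a count of inversions\<close>

definition inversions :: "nat \<Rightarrow> (int \<Rightarrow> int) \<Rightarrow> (int \<times> int) set" where
  "inversions n w = {(p, q). p \<in> I_set n \<and> q \<in> I_set n \<and> p < q \<and> w q < w p}"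

definition negatives :: "nat \<Rightarrow> (int \<Rightarrow> int) \<Rightarrow> int set" where
  "negatives n w = {p \<in> {1..int n}. w p < 0}"

text \<open>Twice the Coxeter length: inversions come in pairs \<open>(p, q)\<close>, \<open>(-q, -p)\<close>, except for those of the form
  \<open>(-p, p)\<close>, which are counted once more by \<open>negatives\<close>.\<close>

definition double_length :: "nat \<Rightarrow> (int \<Rightarrow> int) \<Rightarrow> nat" where
  "double_length n w = card (inversions n w) + card (negatives n w)"

lemma finite_inversions: "finite (inversions n w)"
  by (rule finite_subset[of _ "I_set n \<times> I_set n"]) (auto simp: inversions_def I_set_def)

text \<open>An adjacent transposition reverses only the pairs it swaps. The escape
  \<open>p = 0 \<or> q = 0\<close> is there because \<open>gen 0\<close> exchanges
  \<open>- 1\<close> and \<open>1\<close> across 0, which is an integer but not a position.\<close>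

lemma gen_mono:
  "p < q \<Longrightarrow> gen i p < gen i q \<or>
    (if i = 0 then (p, q) = (- 1, 1) else (p, q) \<in> {(int i, int i + 1), (- int i - 1, - int i)}) \<or> p = 0 \<or> q = 0"
  by (cases "i = 0") (auto simp: gen_zero gen_pos split: if_splits)

text \<open>Moving both positions by \<open>gen i\<close> carries old inversions to inversions; the
  only new ones are the swapped neighbours \<open>E\<close>, one pair for \<open>i = 0\<close> and
  two mirror pairs otherwise.\<close>

lemma inversions_gen:
  assumes w: "w \<in> W n" and i: "i < n" and a: "ascent w i"
  defines "E \<equiv> (if i = 0 then {(- 1, 1)} else {(int i, int i + 1), (- int i - 1, - int i)})"
  shows "inversions n (w \<circ> gen i) = map_prod (gen i) (gen i) ` inversions n w \<union> E"
    and "map_prod (gen i) (gen i) ` inversions n w \<inter> E = {}"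
proof -
  have gI: "gen i p \<in> I_set n \<longleftrightarrow> p \<in> I_set n" for p
    using W_in_I_set[OF gen_in_W[OF i]] .
  have not0: "p \<noteq> 0" if "p \<in> I_set n" for p
    using that by (simp add: I_set_def)
  have E_I: "E \<subseteq> I_set n \<times> I_set n"
    using i by (auto simp: E_def I_set_def)
  have E_asc: "w (gen i q) < w (gen i p)" "p < q" "w p < w q" "gen i q < gen i p" if pq: "(p, q) \<in> E" for p q
  proof -
    have neg: "w (- int i - 1) = - w (int i + 1)"
      using W_minus[OF w, of "int i + 1"] by simp
    show "p < q" "gen i q < gen i p"
      using pq by (auto simp: E_def gen_zero gen_pos split: if_splits)
    have "w p < w q \<and> w (gen i q) < w (gen i p)"
    proof (cases "i = 0")
      case True
      then show ?thesis using pq a W_minus[OF w, of 1]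
        by (simp add: E_def ascent_def gen_zero)
    next
      case False
      have g: "gen i (int i) = int i + 1" "gen i (int i + 1) = int i"
        "gen i (- int i) = - int i - 1" "gen i (- int i - 1) = - int i"
        using False by (simp_all add: gen_pos)
      have a': "w (int i) < w (int i + 1)" using a False by (simp add: ascent_def)
      consider "p = int i" "q = int i + 1" | "p = - int i - 1" "q = - int i"
        using pq False by (auto simp: E_def)
      then show ?thesis
        using a' W_minus[OF w, of "int i"]
        by cases (simp_all only: g neg neg_less_iff_less simp_thms)
    qed
    then show "w p < w q" "w (gen i q) < w (gen i p)" by simp_all
  qed
  have mono: "gen i p < gen i q" if "p < q" "(p, q) \<notin> E" "p \<in> I_set n" "q \<in> I_set n" for p q
    using gen_mono[of p q i] that not0 by (auto simp: E_def split: if_splits)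
  show "inversions n (w \<circ> gen i) = map_prod (gen i) (gen i) ` inversions n w \<union> E" (is "?l = ?r")
  proof (intro equalityI subsetI)
    fix pq assume "pq \<in> ?l"
    then obtain p q where pq: "pq = (p, q)" "p \<in> I_set n" "q \<in> I_set n" "p < q"
      "w (gen i q) < w (gen i p)"
      by (auto simp: inversions_def)
    show "pq \<in> ?r"
    proof (cases "(p, q) \<in> E")
      case False
      then have "(gen i p, gen i q) \<in> inversions n w"
        using pq gI mono[of p q] by (auto simp: inversions_def)
      then have "map_prod (gen i) (gen i) (gen i p, gen i q) \<in> map_prod (gen i) (gen i) ` inversions n w"
        by (rule imageI)
      then show ?thesis using pq by (simp add: gen_gen)
    qed (simp add: pq)
  next
    fix pq assume "pq \<in> ?r"
    then show "pq \<in> ?l"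
    proof
      assume "pq \<in> E"
      then show ?thesis using E_I E_asc by (cases pq) (auto simp: inversions_def)
    next
      assume "pq \<in> map_prod (gen i) (gen i) ` inversions n w"
      then obtain p q where pq: "pq = (gen i p, gen i q)" "p \<in> I_set n" "q \<in> I_set n" "p < q" "w q < w p"
        by (auto simp: inversions_def)
      with mono[of p q] E_asc(3)[of p q] show ?thesis
        by (auto simp: inversions_def gI gen_gen)
    qed
  qed
  have "q < p" if "(gen i p, gen i q) \<in> E" for p q
    using E_asc(4)[OF that] by (simp add: gen_gen)
  then show "map_prod (gen i) (gen i) ` inversions n w \<inter> E = {}"
    by (force simp: inversions_def)
qed

lemma negatives_gen:
  assumes w: "w \<in> W n" and i: "i < n" and a: "ascent w i"
  shows "card (negatives n (w \<circ> gen i)) = card (negatives n w) + (if i = 0 then 1 else 0)"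
proof (cases "i = 0")
  case True
  have "negatives n (w \<circ> gen i) = insert 1 (negatives n w)" "1 \<notin> negatives n w"
    using True a i W_minus[OF w, of 1] by (auto simp: negatives_def ascent_def gen_zero)
  moreover have "finite (negatives n w)"
    by (rule finite_subset[of _ "{1..int n}"]) (auto simp: negatives_def)
  ultimately show ?thesis using True by simp
next
  case False
  have "bij_betw (gen i) (negatives n (w \<circ> gen i)) (negatives n w)"
    using False i
    by (intro bij_betwI[of _ _ _ "gen i"]) (auto simp: negatives_def gen_gen gen_pos)
  then show ?thesis using False bij_betw_same_card by auto
qed

text \<open>The increments are 1 + 1 for \<open>i = 0\<close> and 2 + 0 otherwise; the summand
  \<open>negatives\<close> makes them equal.\<close>

lemma double_length_ascent:
  assumes w: "w \<in> W n" and i: "i < n" and a: "ascent w i"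
  shows "double_length n (w \<circ> gen i) = double_length n w + 2"
proof -
  have "inj (map_prod (gen i) (gen i))"
    by (intro prod.inj_map inj_on_inverseI[where g = "gen i"]) (simp_all add: gen_gen)
  then have "card (map_prod (gen i) (gen i) ` inversions n w) = card (inversions n w)"
    by (rule card_image[OF inj_on_subset[OF _ subset_UNIV]])
  then have "card (inversions n (w \<circ> gen i)) = card (inversions n w) + (if i = 0 then 1 else 2)"
    unfolding inversions_gen(1)[OF assms]
    by (subst card_Un_disjoint) (use inversions_gen(2)[OF assms] in \<open>auto simp: finite_inversions\<close>)
  with negatives_gen[OF assms] show ?thesis
    by (simp add: double_length_def)
qed

lemma double_length_descent:
  assumes w: "w \<in> W n" and i: "i < n" and a: "\<not> ascent w i"
  shows "double_length n w = double_length n (w \<circ> gen i) + 2"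
  using double_length_ascent[OF comp_in_W[OF w gen_in_W[OF i]] i not_ascent_gen[OF w a]]
  by (simp add: gen_comp_gen)

lemma double_length_id: "double_length n id = 0"
proof -
  have "inversions n id = {}" "negatives n id = {}"
    by (auto simp: inversions_def negatives_def)
  then show ?thesis by (simp add: double_length_def)
qed

text \<open>Ascent 0 gives \<open>1 \<le> w 1\<close>, and strictly increasing integers grow by at
  least one per step. Besides identifying the identity, this bound later forces a minimal pattern
  into adjacent positions.\<close>

lemma ascending_pos:
  assumes "\<And>i. i < k \<Longrightarrow> ascent w i" "1 \<le> p" "p \<le> int k"
  shows "p \<le> w p"
proof -
  have "int (Suc i) \<le> w (int (Suc i))" if "Suc i \<le> k" for i
    using that
  proof (induction i)
    case 0 then show ?case using assms(1)[of 0] by (simp add: ascent_def)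
  next
    case (Suc i) then show ?case using assms(1)[of "Suc i"] by (simp add: ascent_def)
  qed
  from this[of "nat (p - 1)"] show ?thesis using assms by simp
qed

lemma ascending_le:
  assumes "\<And>i. p \<le> int i \<Longrightarrow> int i < q \<Longrightarrow> ascent w i" "1 \<le> p" "p \<le> q"
  shows "w p + (q - p) \<le> w q"
proof -
  have "w p + int d \<le> w (p + int d)" if "p + int d \<le> q" for d
    using that
  proof (induction d)
    case (Suc d) then show ?case using assms(1)[of "nat (p + int d)"] assms(2)
      by (simp add: ascent_def ac_simps split: if_splits)
  qed simp
  from this[of "nat (q - p)"] show ?thesis using assms by simp
qed

text \<open>The values at \<open>1\<close>, ..., \<open>n\<close> start at 1 or more, grow by at
  least one per step and end at most at \<open>n\<close>, which leaves no slack.\<close>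

lemma all_ascents_id:
  assumes w: "w \<in> W n" and a: "\<And>i. i < n \<Longrightarrow> ascent w i"
  shows "w = id"
proof -
  have pos: "w p = p" if p: "1 \<le> p" "p \<le> int n" for p
  proof (rule antisym)
    have "w p + (int n - p) \<le> w (int n)"
      using p a by (intro ascending_le) auto
    moreover have "w (int n) \<le> int n"
      using W_in_I_set[OF w, of "int n"] p by (auto simp: I_set_def)
    ultimately show "w p \<le> p" by simp
    show "p \<le> w p" using ascending_pos[of n w p] a p by auto
  qed
  show ?thesis
  proof
    fix p
    consider "1 \<le> p" "p \<le> int n" | "1 \<le> - p" "- p \<le> int n" | "p \<notin> I_set n" 
      by (cases "p \<in> I_set n"; cases "p \<ge> 1") (auto simp: I_set_def)
    then show "w p = id p"
    proof cases
      case 2 then show ?thesis using pos[of "- p"] W_minus[OF w, of p] by simp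
    next
      case 3 then show ?thesis using w by (simp add: W_def permutes_def)
    qed (simp add: pos)
  qed
qed

text \<open>The fold peels letters off the left, but right multiplication is what permutes
  positions; the snoc equation makes reverse induction on expressions possible.\<close>

lemma word_prod_simps [simp]:
  "word_prod [] = id" "word_prod (as @ [a]) = word_prod as \<circ> gen a"
proof -
  have *: "foldr (\<lambda>a f. gen a \<circ> f) as g = word_prod as \<circ> g" for g
    by (induction as) (auto simp: word_prod_def)
  show "word_prod (as @ [a]) = word_prod as \<circ> gen a"
    unfolding *[symmetric] by (simp add: word_prod_def)
qed (simp add: word_prod_def)

lemma word_prod_in_W: "set as \<subseteq> {0..<n} \<Longrightarrow> word_prod as \<in> W n"
  by (induction as rule: rev_induct) (auto intro: id_in_W comp_in_W gen_in_W)

lemma double_length_word_prod_le: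
  "set as \<subseteq> {0..<n} \<Longrightarrow> double_length n (word_prod as) \<le> 2 * length as"
proof (induction as rule: rev_induct)
  case (snoc a as)
  then have "word_prod as \<in> W n" "a < n" by (auto intro: word_prod_in_W)
  with double_length_ascent[OF this] double_length_descent[OF this] snoc show ?case
    by (cases "ascent (word_prod as) a") (auto simp del: comp_apply simp flip: comp_def)
qed (simp add: double_length_id)

lemma exists_expression:
  "w \<in> W n \<Longrightarrow> \<exists>as. expression_of n w as \<and> 2 * length as = double_length n w"
proof (induction "double_length n w" arbitrary: w rule: less_induct)
  case less
  show ?case
  proof (cases "\<forall>i<n. ascent w i")
    case True
    then have "w = id" using all_ascents_id less.prems by auto
    then show ?thesis by (intro exI[of _ "[]"]) (auto simp: expression_of_def double_length_id)
  next
    case False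
    then obtain i where i: "i < n" "\<not> ascent w i" by auto
    note d = double_length_descent[OF less.prems i]
    obtain as where as: "expression_of n (w \<circ> gen i) as" "2 * length as = double_length n (w \<circ> gen i)"
      using less.hyps[of "w \<circ> gen i"] d comp_in_W[OF less.prems gen_in_W[OF i(1)]] by auto
    then have "expression_of n w (as @ [i])"
      using i by (auto simp: expression_of_def gen_comp_gen)
    then show ?thesis using as d by (intro exI[of _ "as @ [i]"]) auto
  qed
qed

lemma reduced_expression_iff:
  assumes "w \<in> W n"
  shows "reduced_expression_of n w as \<longleftrightarrow> expression_of n w as \<and> 2 * length as = double_length n w"
  using exists_expression[OF assms] double_length_word_prod_le
  unfolding reduced_expression_of_def expression_of_def
  by (metis le_antisym mult_le_mono2 nat_mult_le_cancel1 zero_less_numeral)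

text \<open>A letter changes \<open>double_length\<close> by plus or minus 2, and twice the word
  length bounds it from above. Equality for the longer word thus forces equality for the prefix and
  an ascent at the last letter.\<close>

lemma reduced_snoc_iff:
  assumes "set as \<subseteq> {0..<n}" "a < n"
  shows "double_length n (word_prod (as @ [a])) = 2 * length (as @ [a]) \<longleftrightarrow>
    double_length n (word_prod as) = 2 * length as \<and> ascent (word_prod as) a"
proof -
  have W: "word_prod as \<in> W n" using assms by (auto intro: word_prod_in_W)
  show ?thesis
    using double_length_ascent[OF W assms(2)] double_length_descent[OF W assms(2)]
      double_length_word_prod_le[OF assms(1)]
    by (cases "ascent (word_prod as) a") auto
qed

text \<open>The first disjunct covers the factors \<open>s\<^sub>1s\<^sub>0s\<^sub>1\<close>, the second one the factors
  \<open>s\<^sub>is\<^sub>js\<^sub>i\<close> with \<open>j > 0\<close>. Together they say that the word \<open>w(-n)\<dots>w(-1)w(1)\<dots>w(n)\<close> has a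
  decreasing subsequence of length three.\<close>

definition has_321 :: "nat \<Rightarrow> (int \<Rightarrow> int) \<Rightarrow> bool" where
  "has_321 n w \<longleftrightarrow>
    (\<exists>i j. 1 \<le> i \<and> i < j \<and> j \<le> int n \<and> \<bar>w i\<bar> < - w j) \<or>
    (\<exists>i j l. 1 \<le> i \<and> i < j \<and> j < l \<and> l \<le> int n \<and> w j < \<bar>w i\<bar> \<and> \<bar>w l\<bar> < w j)"

lemma has_321_pairI: "1 \<le> i \<Longrightarrow> i < j \<Longrightarrow> j \<le> int n \<Longrightarrow> \<bar>w i\<bar> < - w j \<Longrightarrow> has_321 n w"
  unfolding has_321_def by blast

lemma has_321_tripleI:
  "1 \<le> i \<Longrightarrow> i < j \<Longrightarrow> j < l \<Longrightarrow> l \<le> int n \<Longrightarrow> w j < \<bar>w i\<bar> \<Longrightarrow> \<bar>w l\<bar> < w j \<Longrightarrow> has_321 n w"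
  unfolding has_321_def by blast

text \<open>The last two entries decide the disjunct: either \<open>w l\<close> is so negative that
  \<open>j\<close> and \<open>l\<close> form the pair pattern, or
  \<open>\<bar>w l\<bar> < w j\<close>, since the two absolute values differ.\<close>

lemma has_321_decreasingI:
  assumes "w \<in> W n" "1 \<le> i" "i < j" "j < l" "l \<le> int n" "w j < w i" "w l < w j"
  shows "has_321 n w"
proof (cases "\<bar>w j\<bar> < - w l")
  case True
  then show ?thesis using assms by (intro has_321_pairI[of j l]) auto
next
  case False
  then have "\<bar>w l\<bar> < w j"
    using assms W_abs_eq_iff[OF assms(1), of j l] by auto
  then show ?thesis using assms by (intro has_321_tripleI[of i j l]) auto
qed

text \<open>Positions are tracked by \<open>\<bar>gen t p\<bar>\<close>, since \<open>s\<^sub>0\<close> fixes all positions but changes a sign.\<close>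

lemma abs_gen:
  "1 \<le> p \<Longrightarrow> \<bar>gen t p\<bar> = (if t > 0 \<and> p = int t then int t + 1 else if t > 0 \<and> p = int t + 1 then int t else p)"
  by (cases "t = 0") (auto simp: gen_zero gen_pos)

text \<open>\<open>gen 0\<close> flips the sign of the entry at position 1, so there only absolute
  values survive. The patterns tolerate this: the one entry whose sign they use is at
  \<open>j\<close>, and \<open>j > i \<ge> 1\<close>.\<close>

lemma gen_window:
  assumes w: "w \<in> W n" and t: "t < n" and p: "1 \<le> p" "p \<le> int n"
  shows "1 \<le> \<bar>gen t p\<bar>" "\<bar>gen t p\<bar> \<le> int n" "\<bar>(w \<circ> gen t) \<bar>gen t p\<bar>\<bar> = \<bar>w p\<bar>"
    "t > 0 \<or> p \<noteq> 1 \<Longrightarrow> (w \<circ> gen t) \<bar>gen t p\<bar> = w p"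
proof -
  show "1 \<le> \<bar>gen t p\<bar>" "\<bar>gen t p\<bar> \<le> int n"
    using t p by (auto simp: abs_gen)
  consider "t = 0" "p = 1" | "t = 0" "p > 1" | "t > 0" using p by linarith
  then have "\<bar>(w \<circ> gen t) \<bar>gen t p\<bar>\<bar> = \<bar>w p\<bar> \<and>
      (t > 0 \<or> p \<noteq> 1 \<longrightarrow> (w \<circ> gen t) \<bar>gen t p\<bar> = w p)"
  proof cases
    case 1 then show ?thesis using W_minus[OF w, of 1] by (simp add: gen_zero)
  next
    case 2 then show ?thesis by (simp add: gen_zero)
  next
    case 3 then show ?thesis using p by (simp add: abs_gen) (auto simp: gen_pos)
  qed
  then show "\<bar>(w \<circ> gen t) \<bar>gen t p\<bar>\<bar> = \<bar>w p\<bar>"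
    "t > 0 \<or> p \<noteq> 1 \<Longrightarrow> (w \<circ> gen t) \<bar>gen t p\<bar> = w p" by auto
qed

lemma gen_window_less:
  assumes "1 \<le> p" "p < q" "p \<noteq> int t \<or> q \<noteq> int t + 1"
  shows "\<bar>gen t p\<bar> < \<bar>gen t q\<bar>"
  using assms by (auto simp: abs_gen)

lemma has_321_pair_gen:
  assumes w: "w \<in> W n" and t: "t < n"
    and ij: "1 \<le> i" "i < j" "j \<le> int n" "\<bar>w i\<bar> < - w j" "i \<noteq> int t \<or> j \<noteq> int t + 1"
  shows "has_321 n (w \<circ> gen t)"
proof (rule has_321_pairI[of "\<bar>gen t i\<bar>" "\<bar>gen t j\<bar>"])
  have "\<bar>(w \<circ> gen t) \<bar>gen t i\<bar>\<bar> = \<bar>w i\<bar>"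
    by (rule gen_window(3)[OF w t]) (use ij in linarith)+
  moreover have "(w \<circ> gen t) \<bar>gen t j\<bar> = w j"
    by (rule gen_window(4)[OF w t]) (use ij in linarith)+
  ultimately show "\<bar>(w \<circ> gen t) \<bar>gen t i\<bar>\<bar> < - (w \<circ> gen t) \<bar>gen t j\<bar>"
    using ij(4) by metis
  show "1 \<le> \<bar>gen t i\<bar>" by (rule gen_window(1)[OF w t]) (use ij(1-3) in simp_all)
  show "\<bar>gen t j\<bar> \<le> int n" by (rule gen_window(2)[OF w t]) (use ij(1-3) in simp_all)
  show "\<bar>gen t i\<bar> < \<bar>gen t j\<bar>" by (rule gen_window_less) (fact ij)+
qed

lemma has_321_triple_gen:
  assumes w: "w \<in> W n" and t: "t < n"
    and ijl: "1 \<le> i" "i < j" "j < l" "l \<le> int n" "w j < \<bar>w i\<bar>" "\<bar>w l\<bar> < w j"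
      "i \<noteq> int t \<or> j \<noteq> int t + 1" "j \<noteq> int t \<or> l \<noteq> int t + 1"
  shows "has_321 n (w \<circ> gen t)"
proof (rule has_321_tripleI[of "\<bar>gen t i\<bar>" "\<bar>gen t j\<bar>" "\<bar>gen t l\<bar>"])
  have "\<bar>(w \<circ> gen t) \<bar>gen t i\<bar>\<bar> = \<bar>w i\<bar>" "\<bar>(w \<circ> gen t) \<bar>gen t l\<bar>\<bar> = \<bar>w l\<bar>"
    by (rule gen_window(3)[OF w t]; use ijl in linarith)+
  moreover have "(w \<circ> gen t) \<bar>gen t j\<bar> = w j"
    by (rule gen_window(4)[OF w t]) (use ijl in linarith)+
  ultimately show "(w \<circ> gen t) \<bar>gen t j\<bar> < \<bar>(w \<circ> gen t) \<bar>gen t i\<bar>\<bar>"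
    "\<bar>(w \<circ> gen t) \<bar>gen t l\<bar>\<bar> < (w \<circ> gen t) \<bar>gen t j\<bar>"
    by (simp_all only: ijl(5,6))
  show "1 \<le> \<bar>gen t i\<bar>" by (rule gen_window(1)[OF w t]) (use ijl(1-4) in simp_all)
  show "\<bar>gen t l\<bar> \<le> int n" by (rule gen_window(2)[OF w t]) (use ijl(1-4) in simp_all)
  show "\<bar>gen t i\<bar> < \<bar>gen t j\<bar>" by (rule gen_window_less) (fact ijl)+
  show "\<bar>gen t j\<bar> < \<bar>gen t l\<bar>" by (rule gen_window_less[OF _ ijl(3,8)]) (use ijl(1-4) in simp)
qed

text \<open>An ascent can disturb a pattern only by swapping \<open>i\<close> and \<open>j\<close>
  of a triple, because the other neighbouring entries of a pattern are descents. Then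
  \<open>w i < w j < \<bar>w i\<bar>\<close> makes \<open>w i\<close> negative, and the swapped
  entries form a pair pattern.\<close>

lemma has_321_ascent:
  assumes w: "w \<in> W n" and t: "t < n" "ascent w t" and b: "has_321 n w"
  shows "has_321 n (w \<circ> gen t)"
  using b[unfolded has_321_def]
proof (elim disjE exE conjE)
  fix i j assume ij: "1 \<le> i" "i < j" "j \<le> int n" "\<bar>w i\<bar> < - w j"
  then show ?thesis
    using t by (intro has_321_pair_gen[OF w t(1) ij]) (auto simp: ascent_def)
next
  fix i j l
  assume ijl: "1 \<le> i" "i < j" "j < l" "l \<le> int n" "w j < \<bar>w i\<bar>" "\<bar>w l\<bar> < w j"
  show ?thesis
  proof (cases "i = int t \<and> j = int t + 1")
    case True
    then have "w i < w j" "(w \<circ> gen t) i = w j" "(w \<circ> gen t) j = w i"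
      using ijl(1) t(2) by (simp_all add: ascent_def gen_pos split: if_splits)
    then have "\<bar>(w \<circ> gen t) i\<bar> < - (w \<circ> gen t) j"
      using ijl(5,6) by linarith
    then show "has_321 n (w \<circ> gen t)" using ijl(1-4) by (intro has_321_pairI[of i j]) auto
  next
    case False
    moreover have "j \<noteq> int t \<or> l \<noteq> int t + 1"
      using ijl(1,2,6) t(2) by (auto simp: ascent_def split: if_splits)
    ultimately show "has_321 n (w \<circ> gen t)"
      by (intro has_321_triple_gen[OF w t(1) ijl]) auto
  qed
qed

section \<open>Braids in reduced words and 321 patterns\<close>

definition has_braid :: "nat \<Rightarrow> nat list \<Rightarrow> bool" where
  "has_braid n as \<longleftrightarrow> (\<exists>us vs i j. as = us @ [i, j, i] @ vs \<and>
          i \<in> {1..<n} \<and> j \<in> {0..<n} \<and> \<bar>int i - int j\<bar> = 1)"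

lemma W_b_iff: "w \<in> W_b n \<longleftrightarrow> w \<in> W n \<and> (\<forall>as. reduced_expression_of n w as \<longrightarrow> \<not> has_braid n as)"
  by (auto simp: W_b_def has_braid_def)

lemma reduced_braid_has_321:
  assumes as: "set as \<subseteq> {0..<n}" "double_length n (word_prod as) = 2 * length as" 
    and br: "has_braid n as"
  shows "has_321 n (word_prod as)"
proof -
  obtain us vs i j where eq: "as = us @ [i, j, i] @ vs"
    and ij: "1 \<le> i" "i < n" "j < n" "\<bar>int i - int j\<bar> = 1"
    using br by (auto simp: has_braid_def)
  have "set (us @ [i, j, i] @ vs) \<subseteq> {0..<n} \<Longrightarrow>
      double_length n (word_prod (us @ [i, j, i] @ vs)) = 2 * length (us @ [i, j, i] @ vs) \<Longrightarrow>
      has_321 n (word_prod (us @ [i, j, i] @ vs))"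
  proof (induction vs rule: rev_induct)
    case Nil
    define u where "u = word_prod us"
    have us: "set us \<subseteq> {0..<n}" using Nil by auto
    then have u: "u \<in> W n" by (simp add: u_def word_prod_in_W)
    have e: "word_prod (us @ [i]) = u \<circ> gen i" "word_prod (us @ [i, j]) = u \<circ> gen i \<circ> gen j"
      "word_prod (us @ [i, j, i]) = u \<circ> gen i \<circ> gen j \<circ> gen i"
      using word_prod_simps(2)[of us i] word_prod_simps(2)[of "us @ [i]" j] word_prod_simps(2)[of "us @ [i, j]" i]
      unfolding u_def by simp_all
    have 3: "double_length n (word_prod (us @ [i, j])) = 2 * length (us @ [i, j])"
      "ascent (word_prod (us @ [i, j])) i"
      using reduced_snoc_iff[of "us @ [i, j]" n i] Nil us ij by (simp_all del: word_prod_simps)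
    have 2: "double_length n (word_prod (us @ [i])) = 2 * length (us @ [i])"
      "ascent (word_prod (us @ [i])) j"
      using reduced_snoc_iff[of "us @ [i]" n j] 3(1) us ij by (simp_all del: word_prod_simps)
    have 1: "ascent (word_prod us) i"
      using reduced_snoc_iff[of us n i] 2(1) us ij by (simp del: word_prod_simps)
    have a: "ascent (u \<circ> gen i \<circ> gen j) i" "ascent (u \<circ> gen i) j" "ascent u i"
      using 1 2(2) 3(2) unfolding e by (simp_all add: u_def)
    have v: "u \<circ> gen i \<circ> gen j \<circ> gen i \<in> W n"
      using u ij by (intro comp_in_W gen_in_W) auto
    have "has_321 n (u \<circ> gen i \<circ> gen j \<circ> gen i)"
    proof -
      \<comment> \<open>For \<open>j = 0\<close> the braid negates the second entry; otherwise it
        reverses three increasing neighbours, starting at the smaller of \<open>i\<close> and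
        \<open>j\<close>.\<close>
      consider "j = 0" "i = 1" | "j = i + 1" | "i = j + 1" "j > 0" using ij by linarith
      then show ?thesis
      proof cases
        case 1
        have "u 1 < u 2" "- u 2 < u 1"
          using a ij 1 W_minus[OF u, of 2] by (auto simp: ascent_def gen_zero gen_pos)
        moreover have "(u \<circ> gen i \<circ> gen j \<circ> gen i) 1 = u 1" "(u \<circ> gen i \<circ> gen j \<circ> gen i) 2 = - u 2"
          using 1 W_minus[OF u, of 2] by (simp_all add: gen_zero gen_pos)
        ultimately have "\<bar>(u \<circ> gen i \<circ> gen j \<circ> gen i) 1\<bar> < - (u \<circ> gen i \<circ> gen j \<circ> gen i) 2"
          by linarith
        then show ?thesis
          using ij 1 by (intro has_321_pairI[of 1 2]) auto
      next
        case 2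
        then have "u (int i) < u (int i + 1)" "u (int i) < u (int i + 2)" "u (int i + 1) < u (int i + 2)"
          using a ij by (auto simp: ascent_def gen_pos algebra_simps)
        moreover have "(u \<circ> gen i \<circ> gen j \<circ> gen i) (int i) = u (int i + 2)"
            "(u \<circ> gen i \<circ> gen j \<circ> gen i) (int i + 1) = u (int i + 1)"
            "(u \<circ> gen i \<circ> gen j \<circ> gen i) (int i + 2) = u (int i)"
          using 2 ij by (auto simp: gen_pos algebra_simps)
        ultimately show ?thesis
          using ij 2 v by (intro has_321_decreasingI[of _ n "int i" "int i + 1" "int i + 2"]) auto
      next
        case 3
        then have "u (int j) < u (int j + 1)" "u (int j) < u (int j + 2)" "u (int j + 1) < u (int j + 2)"
          using a ij by (auto simp: ascent_def gen_pos algebra_simps)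
        moreover have "(u \<circ> gen i \<circ> gen j \<circ> gen i) (int j) = u (int j + 2)"
            "(u \<circ> gen i \<circ> gen j \<circ> gen i) (int j + 1) = u (int j + 1)"
            "(u \<circ> gen i \<circ> gen j \<circ> gen i) (int j + 2) = u (int j)"
          using 3 ij by (auto simp: gen_pos algebra_simps)
        ultimately show ?thesis
          using ij 3 v by (intro has_321_decreasingI[of _ n "int j" "int j + 1" "int j + 2"]) auto
      qed
    qed
    then show ?case by (simp only: append_Nil2 e(3))
  next
    case (snoc v vs)
    let ?as = "us @ [i, j, i] @ vs"
    have v: "set ?as \<subseteq> {0..<n}" "v < n" using snoc.prems by auto
    then have "double_length n (word_prod ?as) = 2 * length ?as" "ascent (word_prod ?as) v"
      using snoc.prems reduced_snoc_iff[OF v] by auto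
    with has_321_ascent[OF word_prod_in_W[OF v(1)] v(2)] snoc.IH[OF v(1)]
    have "has_321 n (word_prod (?as @ [v]))" by (simp only: word_prod_simps)
    then show ?case by (simp only: append.assoc)
  qed
  then show ?thesis using as by (simp add: eq)
qed

lemma has_braid_append: "has_braid n as \<Longrightarrow> has_braid n (as @ bs)"
  unfolding has_braid_def by (metis append.assoc)

text \<open>A descent that does not exchange two neighbouring entries of the pattern would keep the
  pattern, contrary to \<open>min\<close>. So \<open>w\<close> ascends everywhere else, and the
  growth bounds for ascending stretches exclude gaps between the positions of the pattern.\<close>

lemma minimal_has_321_cases:
  assumes w: "w \<in> W n" and b: "has_321 n w"
    and min: "\<And>t. t < n \<Longrightarrow> \<not> ascent w t \<Longrightarrow> \<not> has_321 n (w \<circ> gen t)"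
  shows "2 \<le> n \<and> \<bar>w 1\<bar> < - w 2 \<or>
    (\<exists>t. 1 \<le> t \<and> t + 2 \<le> n \<and> w (int t + 1) < w (int t) \<and> w (int t + 2) < w (int t + 1))"
  using b unfolding has_321_def
proof (elim disjE exE conjE)
  fix i j assume ij: "1 \<le> i" "i < j" "j \<le> int n" "\<bar>w i\<bar> < - w j"
  have asc: "ascent w t" if "t < n" "i \<noteq> int t \<or> j \<noteq> int t + 1" for t
    using has_321_pair_gen[OF w that(1) ij that(2)] min[OF that(1)] by auto
  have j: "j = i + 1"
  proof (rule ccontr)
    assume "j \<noteq> i + 1"
    then have "ascent w t" if "t < n" for t using asc[OF that] by auto
    then have "j \<le> w j" by (rule ascending_pos[of n]) (use ij(1-3) in auto)
    then show False using ij by linarith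
  qed
  \<comment> \<open>If \<open>i > 1\<close>, the ascents before \<open>i\<close> give
    \<open>0 < w (i - 1) < w i\<close>. Exchanging the entries at \<open>i\<close> and
    \<open>j\<close> is a descent that leaves a pair pattern at \<open>i - 1\<close> and
    \<open>i\<close>, contrary to \<open>min\<close>.\<close>
  have "i = 1"
  proof (rule ccontr)
    assume i: "i \<noteq> 1"
    define t where "t = nat i"
    have t: "t < n" "i = int t" "t \<ge> 2" using i ij by (auto simp: t_def)
    have pos: "i - 1 \<le> w (i - 1)"
      by (rule ascending_pos[of "nat (i - 1)"]) (use i ij(1-3) in \<open>auto intro!: asc\<close>)
    have less: "w (i - 1) + (i - (i - 1)) \<le> w i"
      by (rule ascending_le) (use i ij(1-3) in \<open>auto intro!: asc\<close>)
    have "has_321 n (w \<circ> gen t)"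
    proof (rule has_321_pairI[of "i - 1" i])
      have "(w \<circ> gen t) (i - 1) = w (i - 1)" "(w \<circ> gen t) i = w j"
        using t j by (simp_all add: gen_pos)
      then show "\<bar>(w \<circ> gen t) (i - 1)\<bar> < - (w \<circ> gen t) i"
        using pos less ij by linarith
    qed (use i ij(1-3) in auto)
    moreover have "w j < w i" using ij by linarith
    then have "\<not> ascent w t" using t j by (simp add: ascent_def)
    ultimately show False using min t by auto
  qed
  then show ?thesis using ij j by simp
next
  fix i j l
  assume ijl: "1 \<le> i" "i < j" "j < l" "l \<le> int n" "w j < \<bar>w i\<bar>" "\<bar>w l\<bar> < w j"
  have asc: "ascent w t" if "t < n" "i \<noteq> int t \<or> j \<noteq> int t + 1" "j \<noteq> int t \<or> l \<noteq> int t + 1" for t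
    using has_321_triple_gen[OF w that(1) ijl that(2,3)] min[OF that(1)] by auto
  \<comment> \<open>All positions before \<open>i\<close> ascend, so \<open>w i\<close> is positive
    and equals \<open>\<bar>w i\<bar>\<close>: the triple is decreasing as it stands.\<close>
  have i: "i \<le> w i"
    by (rule ascending_pos[of "nat i"]) (use ijl(1-4) in \<open>auto intro!: asc\<close>)
  have j: "j = i + 1"
  proof (rule ccontr)
    assume "j \<noteq> i + 1"
    then have "w i + (j - i) \<le> w j"
      by (intro ascending_le) (use ijl(1-4) in \<open>auto intro!: asc\<close>)
    then show False using i ijl by linarith
  qed
  have l: "l = j + 1"
  proof (rule ccontr)
    assume "l \<noteq> j + 1"
    then have "w j + (l - j) \<le> w l"
      by (intro ascending_le) (use ijl(1-4) j in \<open>auto intro!: asc\<close>)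
    then show False using i ijl by linarith
  qed
  have "w j < w i" "w l < w j" using i ijl by linarith+
  then show ?thesis
    by (intro disjI2 exI[of _ "nat i"]) (use j l ijl(1-4) in \<open>auto simp: add.assoc\<close>)
qed

lemma reduced_snoc:
  assumes "w \<in> W n" "a < n" "\<not> ascent w a" "reduced_expression_of n (w \<circ> gen a) as"
  shows "reduced_expression_of n w (as @ [a])"
  using assms double_length_descent[OF assms(1-3)] comp_in_W[OF assms(1) gen_in_W[OF assms(2)]]
  by (auto simp: reduced_expression_iff expression_of_def gen_comp_gen)

lemma reduced_braid:
  assumes w: "w \<in> W n" and ij: "i < n" "j < n" 
    and a: "\<not> ascent w i" "\<not> ascent (w \<circ> gen i) j" "\<not> ascent (w \<circ> gen i \<circ> gen j) i"
  shows "\<exists>us. reduced_expression_of n w (us @ [i, j, i])"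
proof -
  have W: "w \<circ> gen i \<in> W n" "w \<circ> gen i \<circ> gen j \<in> W n" "w \<circ> gen i \<circ> gen j \<circ> gen i \<in> W n"
    using w ij by (auto intro!: comp_in_W gen_in_W)
  obtain us where "reduced_expression_of n (w \<circ> gen i \<circ> gen j \<circ> gen i) us"
    using exists_expression[OF W(3)] reduced_expression_iff[OF W(3)] by auto
  from reduced_snoc[OF w ij(1) a(1) reduced_snoc[OF W(1) ij(2) a(2) reduced_snoc[OF W(2) ij(1) a(3) this]]]
  show ?thesis by auto
qed

lemma has_321_reduced_braid:
  "w \<in> W n \<Longrightarrow> has_321 n w \<Longrightarrow> \<exists>as. reduced_expression_of n w as \<and> has_braid n as"
proof (induction "double_length n w" arbitrary: w rule: less_induct)
  case less
  show ?case
  proof (cases "\<exists>t<n. \<not> ascent w t \<and> has_321 n (w \<circ> gen t)")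
    case True
    then obtain t where t: "t < n" "\<not> ascent w t" "has_321 n (w \<circ> gen t)" by auto
    obtain as where "reduced_expression_of n (w \<circ> gen t) as" "has_braid n as"
      using less.hyps[OF _ comp_in_W[OF less.prems(1) gen_in_W[OF t(1)]] t(3)]
        double_length_descent[OF less.prems(1) t(1,2)] by auto
    with reduced_snoc[OF less.prems(1) t(1,2)] show ?thesis
      using has_braid_append by blast
  next
    case False
    then have min: "\<And>t. t < n \<Longrightarrow> \<not> ascent w t \<Longrightarrow> \<not> has_321 n (w \<circ> gen t)"
      by blast
    have "2 \<le> n \<and> \<bar>w 1\<bar> < - w 2 \<or>
        (\<exists>t. 1 \<le> t \<and> t + 2 \<le> n \<and> w (int t + 1) < w (int t) \<and> w (int t + 2) < w (int t + 1))"
      by (rule minimal_has_321_cases[OF less.prems]) (rule min)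
    then have "\<exists>i j. i \<in> {1..<n} \<and> j \<in> {0..<n} \<and> \<bar>int i - int j\<bar> = 1 \<and>
      \<not> ascent w i \<and> \<not> ascent (w \<circ> gen i) j \<and> \<not> ascent (w \<circ> gen i \<circ> gen j) i"
    proof (elim disjE exE conjE)
      assume "2 \<le> n" "\<bar>w 1\<bar> < - w 2"
      \<comment> \<open>Exchanging the first two entries, negating the first and exchanging again
        are descents by \<open>w 2 < w 1\<close>, \<open>w 2 < 0\<close> and
        \<open>w 1 < - w 2\<close>.\<close>
      then show ?thesis using W_minus[OF less.prems(1), of 2]
        by (intro exI[of _ 1] exI[of _ 0]) (auto simp: ascent_def gen_zero gen_pos)
    next
      fix t assume "1 \<le> t" "t + 2 \<le> n" "w (int t + 1) < w (int t)" "w (int t + 2) < w (int t + 1)"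
      then show ?thesis
        by (intro exI[of _ t] exI[of _ "t + 1"]) (auto simp: ascent_def gen_pos algebra_simps)
    qed
    then obtain i j where ij: "i \<in> {1..<n}" "j \<in> {0..<n}" "\<bar>int i - int j\<bar> = 1"
      and a: "\<not> ascent w i" "\<not> ascent (w \<circ> gen i) j" "\<not> ascent (w \<circ> gen i \<circ> gen j) i"
      by blast
    obtain us where "reduced_expression_of n w (us @ [i, j, i])"
      using reduced_braid[OF less.prems(1) _ _ a] ij by auto
    moreover have "has_braid n (us @ [i, j, i])"
      unfolding has_braid_def using ij
      by (intro exI[of _ us] exI[of _ "[]"] exI[of _ i] exI[of _ j]) auto
    ultimately show ?thesis by blast
  qed
qed

theorem W_b_iff_not_has_321: "w \<in> W n \<Longrightarrow> w \<in> W_b n \<longleftrightarrow> \<not> has_321 n w"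
  using has_321_reduced_braid[of w n] reduced_braid_has_321[of _ n]
  by (auto simp: W_b_iff reduced_expression_iff expression_of_def)

section \<open>Domino insertion in general\<close>

lemma bump_disjoint: "d \<inter> \<mu> = {} \<Longrightarrow> bump \<mu> d = d"
  by (simp add: bump_def)

lemma bump_singleton: "d \<inter> \<mu> = {(k, l)} \<Longrightarrow> bump \<mu> d = insert (k + 1, l + 1) d - \<mu>"
  by (simp add: bump_def)

lemma bump_hdomino: "hdomino k l \<subseteq> \<mu> \<Longrightarrow> bump \<mu> (hdomino k l) = row_end \<mu> (k + 1)"
  by (auto simp: bump_def hdomino_def is_singleton_def Int_absorb2)

lemma bump_vdomino: "vdomino k l \<subseteq> \<mu> \<Longrightarrow> bump \<mu> (vdomino k l) = column_end \<mu> (l + 1)"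
  by (auto simp: bump_def hdomino_def vdomino_def is_singleton_def Int_absorb2 doubleton_eq_iff)

text \<open>Weaker than being a domino, but preserved by \<open>bump\<close> over an arbitrary cell
  set: after an insertion has left two rows, only this and the set of labels are still
  tracked.\<close>

definition small :: "cell set \<Rightarrow> bool" where
  "small d \<longleftrightarrow> finite d \<and> card d \<le> 2"

lemma small_pair: "small {x, y}"
  by (simp add: small_def card_insert_if)

lemma small_subset_of_not_singleton:
  assumes "small d" "d \<inter> \<mu> \<noteq> {}" "\<not> is_singleton (d \<inter> \<mu>)"
  shows "d \<subseteq> \<mu>"
proof -
  have "card (d \<inter> \<mu>) \<noteq> 0" "card (d \<inter> \<mu>) \<noteq> 1"
    using assms by (auto simp: small_def is_singleton_altdef)
  then have "card d \<le> card (d \<inter> \<mu>)"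
    using assms(1) by (simp add: small_def)
  then have "d \<inter> \<mu> = d"
    using assms(1) by (intro card_seteq) (auto simp: small_def)
  then show ?thesis by auto
qed

lemma small_bump:
  assumes "small d" shows "small (bump \<mu> d)"
proof (cases "is_singleton (d \<inter> \<mu>)")
  case True
  then obtain k l where kl: "d \<inter> \<mu> = {(k, l)}" by (auto simp: is_singleton_def)
  then have b: "bump \<mu> d \<subseteq> insert (k + 1, l + 1) (d - {(k, l)})"
    unfolding bump_singleton[OF kl] by blast
  have "(k, l) \<in> d" using kl by auto
  then have "card (d - {(k, l)}) \<le> 1" using assms by (auto simp: small_def)
  then have "card (insert (k + 1, l + 1) (d - {(k, l)})) \<le> 2"
    using assms by (simp add: small_def card_insert_if)
  with card_mono[OF _ b] finite_subset[OF b] assms show ?thesis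
    by (auto simp: small_def)
next
  case False
  then show ?thesis using assms small_pair
    by (auto simp: bump_def row_end_def column_end_def hdomino_def vdomino_def)
qed

text \<open>A cell that \<open>bump\<close> takes away from \<open>d\<close> was already in
  \<open>\<mu>\<close>. Over a whole insertion shapes therefore only grow, which makes a visit to
  row three irreversible.\<close>

lemma bump_Un_superset:
  assumes "small d" shows "d \<subseteq> \<mu> \<union> bump \<mu> d"
proof -
  consider "d \<inter> \<mu> = {}" | k l where "d \<inter> \<mu> = {(k, l)}" | "d \<subseteq> \<mu>"
    using small_subset_of_not_singleton[OF assms, of \<mu>] by (auto simp: is_singleton_def)
  then show ?thesis
  proof cases
    case 2
    show ?thesis unfolding bump_singleton[OF 2] by blast
  qed (auto simp: bump_disjoint)
qed

lemma shape_upd: "j \<notin> dom S \<Longrightarrow> shape (S(j \<mapsto> d)) = shape S \<union> d"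
  by (auto simp: shape_def domIff)

text \<open>The loop of \<open>domino_insert\<close> with its dominoes passed as an explicit list,
  so that induction on that list replaces lookups in the old tableau.\<close>

definition place_all :: "tableau \<Rightarrow> (nat \<times> cell set) list \<Rightarrow> tableau" where
  "place_all S ds = foldl (\<lambda>S (j, d). place S j d) S ds"

lemma place_all_simps [simp]:
  "place_all S [] = S"
  "place_all S ((j, d) # ds) = place_all (S(j \<mapsto> bump (shape S) d)) ds"
  by (simp_all add: place_all_def place_def)

lemma place_all_superset:
  assumes "distinct (map fst ds)" "dom S \<inter> fst ` set ds = {}" "\<forall>d\<in>snd ` set ds. small d"
  shows "shape S \<union> \<Union> (snd ` set ds) \<subseteq> shape (place_all S ds)"
  using assms
proof (induction ds arbitrary: S)
  case (Cons jd ds)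
  obtain j d where jd: "jd = (j, d)" by force
  have "shape (S(j \<mapsto> bump (shape S) d)) \<union> \<Union> (snd ` set ds) \<subseteq> shape (place_all S (jd # ds))"
    unfolding jd place_all_simps
  proof (rule Cons.IH)
    have "dom (S(j \<mapsto> bump (shape S) d)) = insert j (dom S)" by (auto split: if_splits)
    then show "dom (S(j \<mapsto> bump (shape S) d)) \<inter> fst ` set ds = {}"
      using Cons.prems by (simp only: jd) auto
  qed (use Cons.prems in \<open>auto simp: jd\<close>)
  moreover have "shape (S(j \<mapsto> bump (shape S) d)) = shape S \<union> bump (shape S) d"
    using Cons.prems by (intro shape_upd) (auto simp: jd)
  ultimately show ?case
    using bump_Un_superset[of d "shape S"] Cons.prems by (auto simp: jd)
qed simp

lemma dom_place_all: "dom (place_all S ds) = dom S \<union> fst ` set ds"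
proof (induction ds arbitrary: S)
  case (Cons jd ds)
  have "dom (S(j \<mapsto> d)) = insert j (dom S)" for j d by (auto split: if_splits)
  with Cons show ?case by (cases jd) (simp only: place_all_simps, simp)
qed simp

lemma small_place_all:
  "\<forall>d\<in>ran S. small d \<Longrightarrow> \<forall>d\<in>snd ` set ds. small d \<Longrightarrow> \<forall>d\<in>ran (place_all S ds). small d"
proof (induction ds arbitrary: S)
  case (Cons jd ds)
  obtain j d where jd: "jd = (j, d)" by force
  have "ran (S(j \<mapsto> e)) \<subseteq> insert e (ran S)" for e
    by (auto simp: ran_def)
  moreover have "small (bump (shape S) d)"
    using Cons.prems(2) by (intro small_bump) (simp add: jd)
  ultimately have "\<forall>d\<in>ran (S(j \<mapsto> bump (shape S) d)). small d"
    using Cons.prems(1) by blast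
  then show ?case
    unfolding jd place_all_simps by (rule Cons.IH) (use Cons.prems(2) in \<open>simp add: jd\<close>)
qed simp

lemma domino_insert_eq_place_all:
  "domino_insert T x = place_all
     ((T |` {..<nat \<bar>x\<bar>})(nat \<bar>x\<bar> \<mapsto>
        (if x > 0 then row_end (shape (T |` {..<nat \<bar>x\<bar>})) 1 else column_end (shape (T |` {..<nat \<bar>x\<bar>})) 1)))
     (map (\<lambda>j. (j, the (T j))) (sorted_list_of_set {j \<in> dom T. nat \<bar>x\<bar> < j}))"
  by (simp add: domino_insert_def place_all_def foldl_map Let_def)

lemma domino_insert_superset:
  assumes fin: "finite (dom T)" and small: "\<forall>d\<in>ran T. small d" and x: "nat \<bar>x\<bar> \<notin> dom T"
  shows "shape T \<subseteq> shape (domino_insert T x)"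
    and "dom (domino_insert T x) = insert (nat \<bar>x\<bar>) (dom T)"
    and "\<forall>d\<in>ran (domino_insert T x). small d"
proof -
  let ?a = "nat \<bar>x\<bar>"
  let ?T = "T |` {..<?a}" and ?ds = "map (\<lambda>j. (j, the (T j))) (sorted_list_of_set {j \<in> dom T. ?a < j})"
  define e where "e = (if x > 0 then row_end (shape ?T) 1 else column_end (shape ?T) 1)"
  have e: "small e" by (simp add: e_def row_end_def column_end_def hdomino_def vdomino_def small_pair)
  have eq: "domino_insert T x = place_all (?T(?a \<mapsto> e)) ?ds"
    by (simp add: domino_insert_eq_place_all e_def)
  have set: "fst ` set ?ds = {j \<in> dom T. ?a < j}" "snd ` set ?ds = (\<lambda>j. the (T j)) ` {j \<in> dom T. ?a < j}"
    using fin by (auto simp: image_image)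
  have small_ds: "\<forall>d\<in>snd ` set ?ds. small d"
    unfolding set using small by (auto simp: ran_def)
  have "shape (?T(?a \<mapsto> e)) \<union> \<Union> (snd ` set ?ds) \<subseteq> shape (domino_insert T x)"
    unfolding eq
  proof (rule place_all_superset)
    show "dom (?T(?a \<mapsto> e)) \<inter> fst ` set ?ds = {}"
      unfolding set by auto
  qed (use small_ds in \<open>auto simp: comp_def\<close>)
  moreover have "shape (?T(?a \<mapsto> e)) = shape ?T \<union> e"
    by (rule shape_upd) auto
  moreover have "shape T \<subseteq> shape ?T \<union> \<Union> (snd ` set ?ds)"
  proof
    fix p assume "p \<in> shape T"
    then obtain j d where jd: "T j = Some d" "p \<in> d" by (auto simp: shape_def ran_def)
    then consider "j < ?a" | "?a < j" using x by (cases j ?a rule: linorder_cases) auto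
    then show "p \<in> shape ?T \<union> \<Union> (snd ` set ?ds)"
    proof cases
      case 1
      then show ?thesis using jd by (auto simp: shape_def ran_def restrict_map_def)
    next
      case 2
      then show ?thesis unfolding set using jd by (force simp: dom_def)
    qed
  qed
  ultimately show "shape T \<subseteq> shape (domino_insert T x)" by blast
  show "dom (domino_insert T x) = insert ?a (dom T)"
    unfolding eq dom_place_all set using x by (auto simp: neq_iff)
  have "\<forall>d\<in>ran (?T(?a \<mapsto> e)). small d"
    using small e by (auto simp: ran_def restrict_map_def split: if_splits)
  then show "\<forall>d\<in>ran (domino_insert T x). small d"
    unfolding eq using small_ds by (rule small_place_all)
qed

section \<open>Insertion into tableaux with at most two rows\<close>

text \<open>The Young diagram with rows of lengths \<open>c + m\<close> and \<open>c - m\<close>; the three ways to add a domino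
  without leaving at most two rows change \<open>(c, m)\<close> to \<open>(c + 1, lev m u)\<close>. Truncated
  subtraction in \<open>lev\<close> accounts for vertical dominoes, which occur exactly for \<open>m = 0\<close>.\<close>

definition two_rows :: "nat \<Rightarrow> nat \<Rightarrow> cell set" where
  "two_rows c m = {(k, l). 1 \<le> l \<and> (k = 1 \<and> l \<le> c + m \<or> k = 2 \<and> l \<le> c - m)}"

definition lev :: "nat \<Rightarrow> bool \<Rightarrow> nat" where
  "lev m u = (if u then m + 1 else m - 1)"

definition two_row_domino :: "nat \<Rightarrow> nat \<Rightarrow> bool \<Rightarrow> cell set" where
  "two_row_domino c m u =
     (if u then hdomino 1 (c + m + 1) else if m = 0 then vdomino 1 (c + 1) else hdomino 2 (c - m + 1))"

lemma lev_le: "m \<le> c \<Longrightarrow> lev m u \<le> Suc c"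
  by (auto simp: lev_def)

lemma two_rows_step: "m \<le> c \<Longrightarrow> two_rows (Suc c) (lev m u) = two_rows c m \<union> two_row_domino c m u"
  by (auto simp: two_rows_def two_row_domino_def lev_def hdomino_def vdomino_def split: if_splits)

lemma two_row_domino_disjoint: "m \<le> c \<Longrightarrow> two_row_domino c m u \<inter> two_rows c m = {}"
  by (auto simp: two_rows_def two_row_domino_def hdomino_def vdomino_def)

lemma small_two_row_domino: "small (two_row_domino c m u)"
  by (simp add: two_row_domino_def hdomino_def vdomino_def small_pair)

lemma two_rows_zero [simp]: "two_rows 0 0 = {}"
  by (auto simp: two_rows_def)

lemma row_end_two_rows:
  "row_end (two_rows c m) (Suc 0) = hdomino 1 (c + m + 1)"
  "row_end (two_rows c m) 2 = hdomino 2 (c - m + 1)"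
proof -
  have "{l. (1, l) \<in> two_rows c m} = {1..c + m}" "{l. (2, l) \<in> two_rows c m} = {1..c - m}"
    by (auto simp: two_rows_def)
  then show "row_end (two_rows c m) (Suc 0) = hdomino 1 (c + m + 1)" "row_end (two_rows c m) 2 = hdomino 2 (c - m + 1)"
    by (simp_all add: row_end_def)
qed

lemma column_end_two_rows:
  assumes "c + m < l" shows "column_end (two_rows c m) l = vdomino 1 l"
proof -
  have "{k. (k, l) \<in> two_rows c m} = {}" using assms by (auto simp: two_rows_def)
  then show ?thesis by (simp add: column_end_def)
qed

lemma column_end_first:
  assumes "0 < c" shows "\<exists>k. (k, 1) \<in> column_end (two_rows c m) 1 \<and> 3 \<le> k"
proof -
  have "{k. (k, 1) \<in> two_rows c m} \<subseteq> {1, 2}" "1 \<in> {k. (k, 1) \<in> two_rows c m}"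
    using assms by (auto simp: two_rows_def)
  then have "card {k. (k, 1) \<in> two_rows c m} \<ge> 1"
    by (metis (no_types, lifting) One_nat_def Suc_leI card_gt_0_iff empty_iff finite.emptyI finite.insertI finite_subset)
  then show ?thesis
    by (intro exI[of _ "card {k. (k, 1) \<in> two_rows c m} + 2"]) (simp add: column_end_def vdomino_def)
qed

text \<open>\<open>m\<close> and \<open>m'\<close> are the levels before and after insertion; the relation between them is
  \<open>m' = m + 1 \<or> m = m' = 0\<close> until a domino is bumped from the first row, and \<open>m = m' + 1\<close> afterwards.\<close>

lemma bump_D:
  assumes "m \<le> c" "m' = Suc m \<or> m = 0 \<and> m' = 0"
  shows "bump (two_rows (Suc c) m') (two_row_domino c m False) = two_row_domino (Suc c) m' False"
proof -
  consider "m > 0" "m' = Suc m" | "m = 0" "m' = 1" | "m = 0" "m' = 0" using assms by fastforce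
  then show ?thesis
  proof cases
    case 1
    then have "two_row_domino c m False \<inter> two_rows (Suc c) m' = {}" 
      by (auto simp: two_row_domino_def two_rows_def hdomino_def)
    then show ?thesis using 1 assms by (simp add: bump_disjoint) (simp add: two_row_domino_def)
  next
    case 2
    then have "two_row_domino c m False \<inter> two_rows (Suc c) m' = {(1, c + 1)}" 
      by (auto simp: two_row_domino_def two_rows_def vdomino_def)
    note int = this
    show ?thesis
      unfolding bump_singleton[OF int] using 2
      by (auto simp: two_row_domino_def two_rows_def hdomino_def vdomino_def)
  next
    case 3
    then have "vdomino 1 (c + 1) \<subseteq> two_rows (Suc c) m'" 
      by (auto simp: two_rows_def vdomino_def)
    from bump_vdomino[OF this] 3 show ?thesis
      by (simp add: two_row_domino_def column_end_two_rows)
  qed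
qed

text \<open>If the cells placed so far cover the old domino completely, it moves to the end of row
  two. If they cover only its first cell, both rows now have equal length and it becomes
  vertical.\<close>

lemma bump_U:
  assumes "m \<le> c" "m' = Suc m \<or> m = 0 \<and> m' = 0"
  shows "bump (two_rows (Suc c) m') (two_row_domino c m True) = two_row_domino (Suc c) m' False"
proof -
  consider "m' = Suc m" | "m = 0" "m' = 0" using assms by fastforce
  then show ?thesis
  proof cases
    case 1
    then have "hdomino 1 (c + m + 1) \<subseteq> two_rows (Suc c) m'" 
      by (auto simp: two_rows_def hdomino_def)
    from bump_hdomino[OF this] 1 assms show ?thesis
      by (simp add: two_row_domino_def row_end_two_rows numeral_2_eq_2[symmetric])
  next
    case 2
    then have "two_row_domino c m True \<inter> two_rows (Suc c) m' = {(1, c + 1)}" 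
      by (auto simp: two_row_domino_def two_rows_def hdomino_def)
    note int = this
    show ?thesis
      unfolding bump_singleton[OF int] using 2
      by (auto simp: two_row_domino_def two_rows_def hdomino_def vdomino_def)
  qed
qed

text \<open>The first row has the same length as in the old tableau,
  \<open>c + Suc m = Suc c + m\<close>, so its next domino stays where it is.\<close>

lemma bump_U_after:
  assumes "Suc m \<le> c"
  shows "bump (two_rows (Suc c) m) (two_row_domino c (Suc m) True) = two_row_domino (Suc c) m True"
proof -
  have "two_row_domino c (Suc m) True \<inter> two_rows (Suc c) m = {}"
    by (auto simp: two_row_domino_def two_rows_def hdomino_def)
  then show ?thesis by (simp add: bump_disjoint) (simp add: two_row_domino_def)
qed

text \<open>After the flip the second row is two cells longer than in the old tableau and covers its
  next domino, which is pushed to row three. The old level \<open>Suc m\<close> is positive, so that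
  domino is horizontal.\<close>

lemma bump_D_after:
  assumes "Suc m \<le> c"
  shows "\<exists>k l. (k, l) \<in> bump (two_rows (Suc c) m) (two_row_domino c (Suc m) False) \<and> 3 \<le> k"
proof -
  have "hdomino 2 (c - m) \<subseteq> two_rows (Suc c) m"
    using assms by (auto simp: two_rows_def hdomino_def)
  moreover have "two_row_domino c (Suc m) False = hdomino 2 (c - m)"
    using assms by (simp add: two_row_domino_def Suc_diff_Suc)
  ultimately show ?thesis
    using bump_hdomino[of 2 "c - m"] by (auto simp: row_end_def hdomino_def)
qed

section \<open>Encoding by words in two letters\<close>

abbreviation levels :: "nat \<Rightarrow> bool list \<Rightarrow> nat" where
  "levels m us \<equiv> foldl lev m us"

lemma levels_le: "m \<le> c \<Longrightarrow> levels m us \<le> c + length us"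
proof (induction us arbitrary: m c)
  case (Cons u us)
  then show ?case using Cons.IH[OF lev_le[of m c u]] by simp
qed simp

text \<open>A tableau with at most two rows is encoded by its labels, in increasing order, each
  together with the answer to whether its domino is contained in the first row.\<close>

fun dominoes :: "nat \<Rightarrow> nat \<Rightarrow> (nat \<times> bool) list \<Rightarrow> (nat \<times> cell set) list" where
  "dominoes c m [] = []"
| "dominoes c m ((a, u) # xs) = (a, two_row_domino c m u) # dominoes (Suc c) (lev m u) xs"

lemma map_fst_dominoes [simp]: "map fst (dominoes c m xs) = map fst xs"
  by (induction c m xs rule: dominoes.induct) auto

lemma fst_set_dominoes [simp]: "fst ` set (dominoes c m xs) = fst ` set xs"
  by (metis map_fst_dominoes set_map)

lemma dominoes_append:
  "dominoes c m (xs @ ys) = dominoes c m xs @ dominoes (c + length xs) (levels m (map snd xs)) ys"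
  by (induction c m xs rule: dominoes.induct) auto

lemma small_dominoes: "\<forall>d\<in>snd ` set (dominoes c m xs). small d"
  by (induction c m xs rule: dominoes.induct) (auto simp: small_two_row_domino)

lemma Union_dominoes:
  "m \<le> c \<Longrightarrow> two_rows c m \<union> \<Union> (snd ` set (dominoes c m xs)) = two_rows (c + length xs) (levels m (map snd xs))"
proof (induction c m xs rule: dominoes.induct)
  case (2 c m a u xs)
  then show ?case using two_rows_step[OF 2(2), of u] lev_le[OF 2(2), of u] by (simp add: Un_assoc)
qed simp

definition tab :: "(nat \<times> bool) list \<Rightarrow> tableau" where
  "tab xs = map_of (dominoes 0 0 xs)"

lemma shape_map_of: "distinct (map fst ds) \<Longrightarrow> shape (map_of ds) = \<Union> (snd ` set ds)"
  by (simp add: shape_def ran_distinct)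

lemma shape_tab:
  assumes "distinct (map fst xs)"
  shows "shape (tab xs) = two_rows (length xs) (levels 0 (map snd xs))"
  using assms Union_dominoes[of 0 0 xs] by (simp add: tab_def shape_map_of)

lemma dom_tab: "dom (tab xs) = fst ` set xs"
  by (simp add: tab_def dom_map_of_conv_image_fst)

fun flip_first :: "(nat \<times> bool) list \<Rightarrow> (nat \<times> bool) list" where
  "flip_first [] = []"
| "flip_first ((a, u) # xs) = (a, False) # (if u then xs else flip_first xs)"

lemma map_fst_flip_first [simp]: "map fst (flip_first xs) = map fst xs"
  by (induction xs rule: flip_first.induct) auto

fun downs_ups :: "(nat \<times> bool) list \<Rightarrow> bool" where
  "downs_ups [] \<longleftrightarrow> True"
| "downs_ups ((a, u) # xs) \<longleftrightarrow> (if u then list_all snd xs else downs_ups xs)"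

text \<open>Serves as the negation of \<open>at_most_two_rows\<close> because every larger cell set
  inherits it, whether or not that set is a diagram.\<close>

definition reaches_row_three :: "cell set \<Rightarrow> bool" where
  "reaches_row_three D \<longleftrightarrow> (\<exists>k l. (k, l) \<in> D \<and> 3 \<le> k)"

lemma reaches_row_three_mono: "reaches_row_three D \<Longrightarrow> D \<subseteq> E \<Longrightarrow> reaches_row_three E"
  by (auto simp: reaches_row_three_def)

lemma place_all_dominoes_reaches_row_three:
  assumes "distinct (map fst xs)" "dom S \<inter> fst ` set xs = {}" "reaches_row_three (shape S)"
  shows "reaches_row_three (shape (place_all S (dominoes c m xs)))"
  using assms place_all_superset[of "dominoes c m xs" S] small_dominoes[of c m xs]
  by (intro reaches_row_three_mono[OF assms(3)]) simp

lemma place_all_step_reaches_row_three: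
  assumes "distinct (map fst ((a, u) # xs))" "dom S \<inter> fst ` set ((a, u) # xs) = {}"
    and "reaches_row_three (bump (shape S) (two_row_domino c m u))"
  shows "reaches_row_three (shape (place_all S (dominoes c m ((a, u) # xs))))"
  unfolding dominoes.simps place_all_simps
proof (rule place_all_dominoes_reaches_row_three)
  have "shape (S(a \<mapsto> bump (shape S) (two_row_domino c m u))) = shape S \<union> bump (shape S) (two_row_domino c m u)"
    using assms by (intro shape_upd) auto
  then show "reaches_row_three (shape (S(a \<mapsto> bump (shape S) (two_row_domino c m u))))"
    using reaches_row_three_mono[OF assms(3)] by auto
qed (use assms in \<open>auto split: if_splits\<close>)

lemma map_add_map_of_Cons:
  "a \<notin> fst ` set ds \<Longrightarrow> S(a \<mapsto> d) ++ map_of ds = S ++ map_of ((a, d) # ds)"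
  by (simp add: map_add_upd_left dom_map_of_conv_image_fst)

lemma shape_place_step:
  assumes "shape S = two_rows (Suc c) m" "m \<le> Suc c" "a \<notin> dom S"
  shows "shape (S(a \<mapsto> two_row_domino (Suc c) m u)) = two_rows (Suc (Suc c)) (lev m u)"
  using assms two_rows_step[of m "Suc c" u] by (simp add: shape_upd del: fun_upd_apply)

text \<open>The old dominoes continue from the state \<open>(c, Suc m)\<close>, the new ones from
  \<open>(Suc c, m)\<close>: one domino more, level one less. A U keeps this relation and its cells;
  the first D is forced into row three.\<close>

lemma place_all_after:
  assumes "Suc m \<le> c" "shape S = two_rows (Suc c) m" "distinct (map fst xs)"
    "dom S \<inter> fst ` set xs = {}" 
  shows "(list_all snd xs \<longrightarrow> place_all S (dominoes c (Suc m) xs) = S ++ map_of (dominoes (Suc c) m xs)) \<and>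
    (\<not> list_all snd xs \<longrightarrow> reaches_row_three (shape (place_all S (dominoes c (Suc m) xs))))"
  using assms
proof (induction xs arbitrary: c m S)
  case (Cons au xs)
  obtain a u where au: "au = (a, u)" by force
  show ?case
  proof (cases u)
    case False
    have "reaches_row_three (bump (shape S) (two_row_domino c (Suc m) u))"
      using False bump_D_after[OF Cons.prems(1)] Cons.prems(2) by (simp add: reaches_row_three_def)
    with place_all_step_reaches_row_three[of a u xs S c "Suc m"] Cons.prems False show ?thesis
      unfolding au by simp
  next
    case True
    let ?S = "S(a \<mapsto> two_row_domino (Suc c) m True)"
    have S: "shape ?S = two_rows (Suc (Suc c)) (Suc m)"
      using shape_place_step[of S c m a True] Cons.prems by (auto simp: au lev_def)
    have d: "dom ?S \<inter> fst ` set xs = {}"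
      using Cons.prems by (auto simp: au split: if_splits)
    have e: "place_all S (dominoes c (Suc m) (au # xs)) = place_all ?S (dominoes (Suc c) (Suc (Suc m)) xs)"
      using bump_U_after[OF Cons.prems(1)] Cons.prems(2)
      by (simp add: au True lev_def del: fun_upd_apply)
    have f: "?S ++ map_of (dominoes (Suc c + 1) (Suc m) xs) = S ++ map_of (dominoes (Suc c) m (au # xs))"
      using Cons.prems by (subst map_add_map_of_Cons) (auto simp: au True lev_def)
    show ?thesis
      using Cons.IH[of "Suc m" "Suc c" ?S] Cons.prems S d f unfolding e
      by (simp add: au True del: fun_upd_apply)
  qed
qed simp

text \<open>Before the flip each D stays a D and keeps the relation between \<open>m\<close> and
  \<open>m'\<close>. The first U becomes a D, and from then on the states are related as in
  \<open>place_all_after\<close>; a word without U never gets there.\<close>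

lemma place_all_before:
  assumes "m \<le> c" "m' = Suc m \<or> m = 0 \<and> m' = 0" "shape S = two_rows (Suc c) m'" "distinct (map fst xs)"
    "dom S \<inter> fst ` set xs = {}" 
  shows "(downs_ups xs \<longrightarrow> place_all S (dominoes c m xs) = S ++ map_of (dominoes (Suc c) m' (flip_first xs))) \<and>
    (\<not> downs_ups xs \<longrightarrow> reaches_row_three (shape (place_all S (dominoes c m xs))))"
  using assms
proof (induction xs arbitrary: c m m' S)
  case (Cons au xs)
  obtain a u where au: "au = (a, u)" by force
  let ?S = "S(a \<mapsto> two_row_domino (Suc c) m' False)"
  have m': "m' \<le> Suc c" using Cons.prems by auto
  have S: "shape ?S = two_rows (Suc (Suc c)) (m' - 1)"
    using shape_place_step[of S c m' a False] Cons.prems m' by (auto simp: au lev_def)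
  have d: "dom ?S \<inter> fst ` set xs = {}"
    using Cons.prems by (auto simp: au split: if_splits)
  have e: "place_all S (dominoes c m (au # xs)) = place_all ?S (dominoes (Suc c) (lev m u) xs)"
    using bump_U[OF Cons.prems(1,2)] bump_D[OF Cons.prems(1,2)] Cons.prems(3)
    by (cases u) (simp_all add: au del: fun_upd_apply)
  have f: "?S ++ map_of (dominoes (Suc c + 1) (m' - 1) (if u then xs else flip_first xs)) =
      S ++ map_of (dominoes (Suc c) m' (flip_first (au # xs)))"
    using Cons.prems map_fst_flip_first[of xs]
    by (subst map_add_map_of_Cons) (auto simp: au lev_def simp del: map_fst_flip_first simp flip: set_map)
  show ?case
  proof (cases u)
    case True
    \<comment> \<open>Both alternatives for \<open>m'\<close> give this: either
      \<open>m' = Suc m\<close>, or both levels are 0 and truncation makes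
      \<open>m' - 1 = 0\<close>.\<close>
    have l: "lev m u = Suc (m' - 1)" using Cons.prems(2) True by (auto simp: lev_def)
    show ?thesis
      using place_all_after[of "m' - 1" "Suc c" ?S xs] Cons.prems S d f m' unfolding e l
      by (auto simp: au True simp del: fun_upd_apply)
  next
    case False
    have "lev m u \<le> Suc c" "m' - 1 = Suc (lev m u) \<or> lev m u = 0 \<and> m' - 1 = 0"
      using Cons.prems(1,2) False by (auto simp: lev_def)
    then show ?thesis
      using Cons.IH[of "lev m u" "Suc c" "m' - 1" ?S] Cons.prems S d f unfolding e
      by (auto simp: au False simp del: fun_upd_apply)
  qed
qed simp

section \<open>A single insertion on the encoding\<close>

definition below :: "nat \<Rightarrow> (nat \<times> bool) list \<Rightarrow> (nat \<times> bool) list" where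
  "below a xs = filter (\<lambda>p. fst p < a) xs"

definition above :: "nat \<Rightarrow> (nat \<times> bool) list \<Rightarrow> (nat \<times> bool) list" where
  "above a xs = filter (\<lambda>p. a < fst p) xs"

definition sorted_labels :: "(nat \<times> bool) list \<Rightarrow> bool" where
  "sorted_labels xs \<longleftrightarrow> sorted_wrt (<) (map fst xs)"

lemma sorted_labels_append:
  "sorted_labels (xs @ ys) \<longleftrightarrow> sorted_labels xs \<and> sorted_labels ys \<and> (\<forall>p\<in>set xs. \<forall>q\<in>set ys. fst p < fst q)"
  by (simp add: sorted_labels_def sorted_wrt_append)

lemma sorted_labels_Cons:
  "sorted_labels (p # xs) \<longleftrightarrow> sorted_labels xs \<and> (\<forall>q\<in>set xs. fst p < fst q)"
  by (auto simp: sorted_labels_def)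

lemma sorted_labels_distinct: "sorted_labels xs \<Longrightarrow> distinct (map fst xs)"
  by (simp add: sorted_labels_def strict_sorted_iff)

lemma below_above:
  "sorted_labels xs \<Longrightarrow> a \<notin> fst ` set xs \<Longrightarrow> xs = below a xs @ above a xs"
proof (induction xs)
  case (Cons p xs)
  show ?case
  proof (cases "fst p < a")
    case True
    then show ?thesis using Cons by (simp add: below_def above_def sorted_labels_Cons)
  next
    case False
    then have "filter (\<lambda>p. fst p < a) xs = []" "filter (\<lambda>p. a < fst p) xs = xs"
      using Cons.prems by (auto simp: sorted_labels_Cons filter_empty_conv filter_id_conv)
    then show ?thesis using False Cons.prems by (auto simp: below_def above_def)
  qed
qed (simp add: below_def above_def)

definition insert_letter :: "int \<Rightarrow> (nat \<times> bool) list \<Rightarrow> (nat \<times> bool) list" where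
  "insert_letter x xs = below (nat \<bar>x\<bar>) xs @ (nat \<bar>x\<bar>, x > 0) # flip_first (above (nat \<bar>x\<bar>) xs)"

definition insertable :: "int \<Rightarrow> (nat \<times> bool) list \<Rightarrow> bool" where
  "insertable x xs \<longleftrightarrow> (x > 0 \<or> below (nat \<bar>x\<bar>) xs = []) \<and> downs_ups (above (nat \<bar>x\<bar>) xs)"

text \<open>The labels below \<open>\<bar>x\<bar>\<close> form an encoded tableau of their own,
  ending in the state \<open>(c, m)\<close>, and the labels above are the dominoes continuing from
  that state.\<close>

lemma domino_insert_tab_eq:
  assumes xs: "sorted_labels xs" and a: "nat \<bar>x\<bar> \<notin> fst ` set xs"
  defines "b \<equiv> below (nat \<bar>x\<bar>) xs"
  defines "c \<equiv> length b" and "m \<equiv> levels 0 (map snd b)"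
  shows "domino_insert (tab xs) x =
    place_all ((tab b)(nat \<bar>x\<bar> \<mapsto> (if x > 0 then row_end (two_rows c m) 1 else column_end (two_rows c m) 1)))
      (dominoes c m (above (nat \<bar>x\<bar>) xs))"
proof -
  let ?a = "nat \<bar>x\<bar>"
  let ?u = "above ?a xs"
  have split: "xs = b @ ?u" using below_above[OF xs a] by (simp add: b_def)
  have sorted: "sorted_labels b" "sorted_labels ?u"
    using xs by (metis split sorted_labels_append)+
  have tab: "tab xs = map_of (dominoes 0 0 b @ dominoes c m ?u)"
    unfolding tab_def by (subst split) (simp add: dominoes_append c_def m_def)
  have dist: "distinct (map fst (dominoes 0 0 b @ dominoes c m ?u))"
    using sorted_labels_distinct[OF xs] by (subst (asm) split) simp
  have lt: "\<forall>p\<in>set b. fst p < ?a" "\<forall>p\<in>set ?u. ?a < fst p"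
    by (auto simp: b_def below_def above_def)
  have "tab xs |` {..<?a} = tab b"
  proof
    fix j
    have "map_of (dominoes c m ?u) j = None" if "j < ?a"
      using that lt(2) by (auto simp: map_of_eq_None_iff)
    moreover have "map_of (dominoes 0 0 b) j = None" if "\<not> j < ?a"
      using that lt(1) by (auto simp: map_of_eq_None_iff)
    ultimately show "(tab xs |` {..<?a}) j = tab b j"
      unfolding tab by (cases "j < ?a") (auto simp: restrict_map_def tab_def map_add_def split: option.split)
  qed
  moreover have "sorted_list_of_set {j \<in> dom (tab xs). ?a < j} = map fst ?u"
  proof -
    have "{j \<in> dom (tab xs). ?a < j} = set (map fst ?u)"
      by (auto simp: dom_tab above_def)
    then show ?thesis
      using sorted(2) by (simp only: sorted_list_of_set.idem_if_sorted_distinct sorted_labels_def strict_sorted_iff)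
  qed
  moreover have "map (\<lambda>j. (j, the (tab xs j))) (map fst ?u) = dominoes c m ?u"
  proof -
    have "(j, the (tab xs j)) = (j, d)" if "(j, d) \<in> set (dominoes c m ?u)" for j d
      unfolding tab using map_of_is_SomeI[OF dist, of j d] that by simp
    then have "map (\<lambda>j. (j, the (tab xs j))) (map fst (dominoes c m ?u)) = dominoes c m ?u"
      unfolding map_map by (intro map_idI) auto
    then show ?thesis by simp
  qed
  moreover have "shape (tab b) = two_rows c m"
    using shape_tab[OF sorted_labels_distinct[OF sorted(1)]] by (simp add: c_def m_def)
  ultimately show ?thesis
    unfolding domino_insert_eq_place_all by (simp only:)
qed

lemma domino_insert_tab:
  assumes xs: "sorted_labels xs" and x: "nat \<bar>x\<bar> \<notin> fst ` set xs" "x \<noteq> 0"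
  shows "(insertable x xs \<longrightarrow> domino_insert (tab xs) x = tab (insert_letter x xs)) \<and>
    (\<not> insertable x xs \<longrightarrow> reaches_row_three (shape (domino_insert (tab xs) x)))"
proof -
  let ?a = "nat \<bar>x\<bar>"
  define b u where "b = below ?a xs" and "u = above ?a xs"
  define c m where "c = length b" and "m = levels 0 (map snd b)"
  define d where "d = (if x > 0 then row_end (two_rows c m) 1 else column_end (two_rows c m) 1)"
  let ?S = "(tab b)(?a \<mapsto> d)"
  note eq = domino_insert_tab_eq[OF xs x(1), folded b_def u_def, folded c_def m_def, folded d_def]
  have split: "xs = b @ u" using below_above[OF xs x(1)] by (simp add: b_def u_def)
  have sorted: "sorted_labels b" "sorted_labels u"
    using xs by (metis split sorted_labels_append)+
  have m: "m \<le> c" using levels_le[of 0 0 "map snd b"] by (simp add: c_def m_def)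
  have notin: "?a \<notin> dom (tab b)" "?a \<notin> fst ` set u" using x(1) by (auto simp: split dom_tab)
  have dist: "distinct (map fst u)" by (rule sorted_labels_distinct[OF sorted(2)])
  have disj: "dom ?S \<inter> fst ` set u = {}"
  proof -
    have "fst ` set b \<inter> fst ` set u = {}"
      using sorted_labels_distinct[OF xs] by (subst (asm) split) simp
    moreover have "dom ?S = insert ?a (fst ` set b)"
      using dom_tab[of b] by (auto split: if_splits)
    ultimately show ?thesis using notin by auto
  qed
  have shape_S: "shape ?S = two_rows c m \<union> d"
    using shape_upd[OF notin(1)] shape_tab[OF sorted_labels_distinct[OF sorted(1)]] by (simp add: c_def m_def)
  show ?thesis
  proof (cases "x > 0 \<or> b = []")
    case True
    \<comment> \<open>For negative \<open>x\<close> the tableau built so far is empty, so the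
      vertical domino starts column 1 and is the D domino of level 0.\<close>
    have d: "d = two_row_domino c m (x > 0)"
      using True x(2) by (auto simp: d_def two_row_domino_def c_def m_def row_end_two_rows
          column_end_two_rows[of 0 0, simplified])
    define m' where "m' = lev m (x > 0)"
    have "shape ?S = two_rows (Suc c) m'"
      using shape_S two_rows_step[OF m, of "x > 0"] by (simp only: m'_def d)
    moreover have "m' = Suc m \<or> m = 0 \<and> m' = 0"
      using True by (auto simp: m'_def lev_def m_def)
    ultimately have *: "(downs_ups u \<longrightarrow> place_all ?S (dominoes c m u) =
          ?S ++ map_of (dominoes (Suc c) m' (flip_first u))) \<and>
        (\<not> downs_ups u \<longrightarrow> reaches_row_three (shape (place_all ?S (dominoes c m u))))"
      using m dist disj by (intro place_all_before) auto
    have "?S ++ map_of (dominoes (Suc c) m' (flip_first u)) = tab (insert_letter x xs)"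
    proof -
      have "fst ` set (flip_first u) = fst ` set u"
        by (metis map_fst_flip_first set_map)
      moreover have "fst ` set b \<inter> fst ` set u = {}"
        using sorted_labels_distinct[OF xs] by (subst (asm) split) simp
      ultimately have dom: "dom (map_of (dominoes 0 0 b)) \<inter> dom (map_of ((?a, d) # dominoes (Suc c) m' (flip_first u))) = {}"
        using notin(1) by (simp add: dom_map_of_conv_image_fst dom_tab)
      have "?S ++ map_of (dominoes (Suc c) m' (flip_first u)) =
          tab b ++ map_of ((?a, d) # dominoes (Suc c) m' (flip_first u))"
        using notin(2) \<open>fst ` set (flip_first u) = fst ` set u\<close> by (intro map_add_map_of_Cons) simp
      also have "\<dots> = map_of ((?a, d) # dominoes (Suc c) m' (flip_first u)) ++ tab b"
        using dom unfolding tab_def by (rule map_add_comm)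
      also have "\<dots> = tab (insert_letter x xs)"
        by (simp only: insert_letter_def tab_def dominoes_append b_def[symmetric] u_def[symmetric]
          c_def[symmetric] m_def[symmetric] dominoes.simps map_of_append add_0 d m'_def)
      finally show ?thesis .
    qed
    then show ?thesis
      using * True by (simp only: eq insertable_def b_def[symmetric] u_def[symmetric]) auto
  next
    case False
    \<comment> \<open>The first column is nonempty here, so a vertical domino placed below it ends
      in row three or lower.\<close>
    then have "reaches_row_three d"
      using column_end_first[of c m] by (auto simp: reaches_row_three_def d_def c_def)
    then have "reaches_row_three (shape ?S)" unfolding shape_S by (rule reaches_row_three_mono) auto
    then have "reaches_row_three (shape (place_all ?S (dominoes c m u)))"
      using dist disj by (intro place_all_dominoes_reaches_row_three)
    then show ?thesis
      using False by (simp only: eq insertable_def b_def[symmetric]) simp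
  qed
qed

section \<open>Insertion of a whole word\<close>

lemma sorted_labels_cong: "map fst xs = map fst ys \<Longrightarrow> sorted_labels xs = sorted_labels ys"
  by (simp add: sorted_labels_def)

lemma fst_set_flip_first [simp]: "fst ` set (flip_first xs) = fst ` set xs"
  by (metis map_fst_flip_first set_map)

lemma sorted_labels_insert_letter:
  assumes "sorted_labels xs" shows "sorted_labels (insert_letter x xs)"
proof -
  have "sorted_labels (below (nat \<bar>x\<bar>) xs)" "sorted_labels (above (nat \<bar>x\<bar>) xs)"
    using assms by (auto simp: sorted_labels_def below_def above_def sorted_wrt_map intro: sorted_wrt_filter)
  moreover have "\<forall>p\<in>set (flip_first xs). \<exists>q\<in>set xs. fst p = fst q" for xs
    using fst_set_flip_first[of xs] by (metis imageE image_eqI)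
  then have "\<forall>p\<in>set (flip_first (above (nat \<bar>x\<bar>) xs)). nat \<bar>x\<bar> < fst p"
    by (fastforce simp: above_def)
  moreover have "sorted_labels (flip_first (above (nat \<bar>x\<bar>) xs)) = sorted_labels (above (nat \<bar>x\<bar>) xs)"
    by (rule sorted_labels_cong) simp
  ultimately show ?thesis
    by (auto simp: insert_letter_def sorted_labels_append sorted_labels_Cons below_def intro: less_trans)
qed

lemma labels_insert_letter:
  assumes "sorted_labels xs" "nat \<bar>x\<bar> \<notin> fst ` set xs"
  shows "fst ` set (insert_letter x xs) = insert (nat \<bar>x\<bar>) (fst ` set xs)"
proof -
  have "fst ` set xs = fst ` set (below (nat \<bar>x\<bar>) xs) \<union> fst ` set (above (nat \<bar>x\<bar>) xs)"
    by (subst below_above[OF assms]) (simp add: image_Un)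
  then show ?thesis by (simp add: insert_letter_def image_Un)
qed

lemma length_insert_letter:
  assumes "sorted_labels xs" "nat \<bar>x\<bar> \<notin> fst ` set xs"
  shows "length (insert_letter x xs) = Suc (length xs)"
proof -
  have "length (flip_first ys) = length ys" for ys
    by (metis length_map map_fst_flip_first)
  then show ?thesis
    by (subst below_above[OF assms]) (simp add: insert_letter_def)
qed

lemma flip_first_False: "(b, False) \<in> set xs \<Longrightarrow> (b, False) \<in> set (flip_first xs)"
  by (induction xs rule: flip_first.induct) auto

lemma flip_first_has_False: "xs \<noteq> [] \<Longrightarrow> \<exists>b. (b, False) \<in> set (flip_first xs)"
  by (cases xs rule: flip_first.cases) auto

lemma flip_first_TrueD: "(b, True) \<in> set (flip_first xs) \<Longrightarrow> (b, True) \<in> set xs"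
  by (induction xs rule: flip_first.induct) (auto split: if_splits)

lemma flip_first_FalseD:
  "sorted_labels xs \<Longrightarrow> (b, False) \<in> set (flip_first xs) \<Longrightarrow>
    (b, False) \<in> set xs \<or> (b, True) \<in> set xs \<and> (\<forall>c. (c, True) \<in> set xs \<longrightarrow> b \<le> c)"
  by (induction xs rule: flip_first.induct) (fastforce simp: sorted_labels_Cons split: if_splits)+

lemma downs_ups_less:
  "sorted_labels xs \<Longrightarrow> downs_ups xs \<Longrightarrow> (a, True) \<in> set xs \<Longrightarrow> (b, False) \<in> set xs \<Longrightarrow> b < a"
  by (induction xs rule: downs_ups.induct)
    (fastforce simp: sorted_labels_Cons list_all_iff split: if_splits)+

lemma not_downs_ups:
  "sorted_labels xs \<Longrightarrow> \<not> downs_ups xs \<Longrightarrow> \<exists>a b. (a, True) \<in> set xs \<and> (b, False) \<in> set xs \<and> a < b"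
  by (induction xs rule: downs_ups.induct)
    (fastforce simp: sorted_labels_Cons list_all_iff split: if_splits)+

lemma insert_letter_False:
  assumes "(b, False) \<in> set xs" "b \<noteq> nat \<bar>x\<bar>"
  shows "(b, False) \<in> set (insert_letter x xs)"
proof (cases "b < nat \<bar>x\<bar>")
  case True
  then show ?thesis using assms by (simp add: insert_letter_def below_def)
next
  case False
  then have "(b, False) \<in> set (above (nat \<bar>x\<bar>) xs)" using assms by (simp add: above_def)
  from flip_first_False[OF this] show ?thesis by (simp add: insert_letter_def)
qed

text \<open>If some label above \<open>\<bar>x\<bar>\<close> is U, the first such U is flipped;
  otherwise all of them are D already. This supplies the D of a blocking pair.\<close>

lemma insert_letter_has_False:
  assumes "b \<in> fst ` set xs" "nat \<bar>x\<bar> < b"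
  shows "\<exists>b > nat \<bar>x\<bar>. (b, False) \<in> set (insert_letter x xs)"
proof -
  have "above (nat \<bar>x\<bar>) xs \<noteq> []" using assms by (auto simp: above_def filter_empty_conv)
  then obtain c where c: "(c, False) \<in> set (flip_first (above (nat \<bar>x\<bar>) xs))"
    using flip_first_has_False by blast
  then have "c \<in> fst ` set (above (nat \<bar>x\<bar>) xs)"
    using fst_set_flip_first by (metis fst_conv image_eqI)
  then show ?thesis using c by (auto simp: insert_letter_def above_def)
qed

lemma insert_letter_True: "(b, True) \<in> set xs \<Longrightarrow> b < nat \<bar>x\<bar> \<Longrightarrow> (b, True) \<in> set (insert_letter x xs)"
  by (auto simp: insert_letter_def below_def)

lemma insert_letter_TrueD:
  "(b, True) \<in> set (insert_letter x xs) \<Longrightarrow> (b, True) \<in> set xs \<or> b = nat \<bar>x\<bar> \<and> x > 0"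
  using flip_first_TrueD[of b "above (nat \<bar>x\<bar>) xs"]
  by (auto simp: insert_letter_def below_def above_def)

lemma insert_letter_FalseD:
  assumes "sorted_labels xs" "(b, False) \<in> set (insert_letter x xs)"
  shows "(b, False) \<in> set xs \<or> b = nat \<bar>x\<bar> \<and> \<not> x > 0 \<or>
    nat \<bar>x\<bar> < b \<and> (b, True) \<in> set xs \<and> (\<forall>c. (c, True) \<in> set xs \<longrightarrow> c \<le> nat \<bar>x\<bar> \<or> b \<le> c)"
proof -
  have "sorted_labels (above (nat \<bar>x\<bar>) xs)"
    using assms(1) by (auto simp: sorted_labels_def above_def sorted_wrt_map intro: sorted_wrt_filter)
  from flip_first_FalseD[OF this, of b] assms(2) show ?thesis
    by (auto simp: insert_letter_def below_def above_def) (meson not_le)+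
qed

lemma insertable_less:
  assumes "sorted_labels xs" "insertable x xs" "(a, True) \<in> set xs" "(b, False) \<in> set xs" "a < b"
    "a \<noteq> nat \<bar>x\<bar>"
  shows "a < nat \<bar>x\<bar>"
proof (rule ccontr)
  assume "\<not> a < nat \<bar>x\<bar>"
  moreover have "sorted_labels (above (nat \<bar>x\<bar>) xs)"
    using assms(1) by (auto simp: sorted_labels_def above_def sorted_wrt_map intro: sorted_wrt_filter)
  ultimately have "b < a"
    using assms by (intro downs_ups_less[of "above (nat \<bar>x\<bar>) xs"]) (auto simp: insertable_def above_def)
  then show False using assms(5) by simp
qed

lemma insertable_pos:
  assumes "insertable x xs" "a \<in> fst ` set xs" "a < nat \<bar>x\<bar>"
  shows "x > 0"
  using assms by (auto simp: insertable_def below_def filter_empty_conv)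

section \<open>Words that stay within two rows\<close>

definition run :: "int list \<Rightarrow> (nat \<times> bool) list" where
  "run = foldl (\<lambda>xs x. insert_letter x xs) []"

lemma run_simps [simp]: "run [] = []" "run (ys @ [x]) = insert_letter x (run ys)"
  by (simp_all add: run_def)

definition runnable :: "int list \<Rightarrow> bool" where
  "runnable ys \<longleftrightarrow> (\<forall>us x vs. ys = us @ x # vs \<longrightarrow> insertable x (run us))"

lemma runnable_Nil [simp]: "runnable []"
  by (simp add: runnable_def)

lemma runnable_snoc [simp]: "runnable (ys @ [x]) \<longleftrightarrow> runnable ys \<and> insertable x (run ys)"
proof
  assume *: "runnable (ys @ [x])"
  have "insertable z (run us)" if "ys = us @ z # vs" for us z vs
    using *[unfolded runnable_def, rule_format, of us z "vs @ [x]"] that by simp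
  then show "runnable ys \<and> insertable x (run ys)"
    using *[unfolded runnable_def, rule_format, of ys x "[]"] by (simp add: runnable_def)
next
  assume *: "runnable ys \<and> insertable x (run ys)"
  show "runnable (ys @ [x])"
    unfolding runnable_def
  proof (intro allI impI)
    fix us z vs assume eq: "ys @ [x] = us @ z # vs"
    show "insertable z (run us)"
    proof (cases vs rule: rev_cases)
      case Nil then show ?thesis using eq * by simp
    next
      case (snoc vs' y)
      then have "ys = us @ z # vs'" using eq by simp
      then show ?thesis using * by (simp add: runnable_def)
    qed
  qed
qed

definition signed_letters :: "int list \<Rightarrow> bool" where
  "signed_letters ys \<longleftrightarrow> 0 \<notin> set ys \<and> distinct (map abs ys)"

lemma signed_letters_snoc [simp]:
  "signed_letters (ys @ [x]) \<longleftrightarrow> signed_letters ys \<and> x \<noteq> 0 \<and> \<bar>x\<bar> \<notin> abs ` set ys"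
  by (auto simp: signed_letters_def)

lemma run_labels:
  "signed_letters ys \<Longrightarrow> sorted_labels (run ys) \<and> fst ` set (run ys) = (\<lambda>x. nat \<bar>x\<bar>) ` set ys"
proof (induction ys rule: rev_induct)
  case (snoc x ys)
  have "nat \<bar>x\<bar> \<notin> fst ` set (run ys)"
    using snoc by (auto simp: image_iff)
  then show ?case using snoc labels_insert_letter sorted_labels_insert_letter by simp
qed (simp add: sorted_labels_def)

lemma run_fresh:
  assumes "signed_letters (ys @ [x])" shows "nat \<bar>x\<bar> \<notin> fst ` set (run ys)"
proof -
  have "fst ` set (run ys) = (\<lambda>x. nat \<bar>x\<bar>) ` set ys" using assms run_labels by simp
  moreover have "\<bar>x\<bar> \<notin> abs ` set ys" using assms by simp
  ultimately show ?thesis by (auto simp: image_iff)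
qed

lemma length_run: "signed_letters ys \<Longrightarrow> length (run ys) = length ys"
proof (induction ys rule: rev_induct)
  case (snoc x ys)
  then show ?case using length_insert_letter run_labels run_fresh[of ys x] by simp
qed simp

definition insert_all :: "int list \<Rightarrow> tableau" where
  "insert_all ys = foldl domino_insert Map.empty ys"

lemma insert_all_simps [simp]:
  "insert_all [] = Map.empty" "insert_all (ys @ [x]) = domino_insert (insert_all ys) x"
  by (simp_all add: insert_all_def)

lemma insert_all_facts:
  "signed_letters ys \<Longrightarrow> finite (dom (insert_all ys)) \<and> (\<forall>d\<in>ran (insert_all ys). small d) \<and>
    dom (insert_all ys) = (\<lambda>x. nat \<bar>x\<bar>) ` set ys"
proof (induction ys rule: rev_induct)
  case (snoc x ys)
  then have "nat \<bar>x\<bar> \<notin> dom (insert_all ys)" by (auto simp: image_iff)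
  with snoc domino_insert_superset[of "insert_all ys" x] show ?case by simp
qed simp

lemma insert_all_tab: 
  "signed_letters ys \<Longrightarrow>
    (runnable ys \<longrightarrow> insert_all ys = tab (run ys)) \<and> (\<not> runnable ys \<longrightarrow> reaches_row_three (shape (insert_all ys)))"
proof (induction ys rule: rev_induct)
  case Nil
  then show ?case by (simp add: tab_def)
next
  case (snoc x ys)
  have ys: "signed_letters ys" using snoc.prems by simp
  show ?case
  proof (cases "runnable ys")
    case True
    then have "insert_all ys = tab (run ys)" using snoc.IH ys by simp
    then show ?thesis
      using True domino_insert_tab[of "run ys" x] run_labels[OF ys] run_fresh[OF snoc.prems] snoc.prems
      by simp
  next
    case False
    have "nat \<bar>x\<bar> \<notin> dom (insert_all ys)"
      using insert_all_facts[OF ys] snoc.prems by (auto simp: image_iff)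
    then have "shape (insert_all ys) \<subseteq> shape (domino_insert (insert_all ys) x)"
      using insert_all_facts[OF ys] by (intro domino_insert_superset) auto
    then show ?thesis using False snoc.IH ys reaches_row_three_mono by auto
  qed
qed

definition word_321 :: "int list \<Rightarrow> bool" where
  "word_321 ys \<longleftrightarrow>
    (\<exists>i j. i < j \<and> j < length ys \<and> \<bar>ys ! i\<bar> < - ys ! j) \<or>
    (\<exists>i j l. i < j \<and> j < l \<and> l < length ys \<and> ys ! j < \<bar>ys ! i\<bar> \<and> \<bar>ys ! l\<bar> < ys ! j)"

text \<open>Followed by a letter of absolute value below \<open>a\<close>, the two positions
  complete a triple pattern. An old D is handled by induction, or with \<open>x\<close> as the
  smaller entry if \<open>a\<close> is new. An inserted negative letter cannot have the smaller
  label \<open>a\<close> below it. For a freshly flipped \<open>b\<close> no U lies strictly between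
  \<open>\<bar>x\<bar>\<close> and \<open>b\<close>, so \<open>a \<le> x < b\<close>; this case is
  why \<open>a\<close> is only a lower bound for the letter at \<open>j\<close>.\<close>

lemma run_descent:
  "signed_letters ys \<Longrightarrow> runnable ys \<Longrightarrow> (a, True) \<in> set (run ys) \<Longrightarrow> (b, False) \<in> set (run ys) \<Longrightarrow> a < b \<Longrightarrow>
    \<exists>i j. i < j \<and> j < length ys \<and> int a \<le> ys ! j \<and> ys ! j < \<bar>ys ! i\<bar>"
proof (induction ys arbitrary: a b rule: rev_induct)
  case (snoc x ys)
  have ys: "signed_letters ys" "runnable ys" "insertable x (run ys)" using snoc.prems by auto
  note run = run_labels[OF ys(1)]
  have old: ?case if "i < j" "j < length ys" "int a \<le> ys ! j" "ys ! j < \<bar>ys ! i\<bar>" for i j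
    using that by (intro exI[of _ i] exI[of _ j]) (auto simp: nth_append)
  have new: ?case if b: "b \<in> fst ` set (run ys)" and x: "int a \<le> x" "x < int b" 
  proof -
    obtain y where "y \<in> set ys" "b = nat \<bar>y\<bar>" using b run by auto
    then obtain i where "i < length ys" "int b = \<bar>ys ! i\<bar>" by (auto simp: in_set_conv_nth)
    then show ?thesis
      using x by (intro exI[of _ i] exI[of _ "length ys"]) (auto simp: nth_append)
  qed
  have a: "(a, True) \<in> set (run ys) \<or> a = nat \<bar>x\<bar> \<and> x > 0"
    using snoc.prems by (intro insert_letter_TrueD) simp
  consider "(b, False) \<in> set (run ys)" | "b = nat \<bar>x\<bar>" "\<not> x > 0"
    | "nat \<bar>x\<bar> < b" "(b, True) \<in> set (run ys)" "\<forall>c. (c, True) \<in> set (run ys) \<longrightarrow> c \<le> nat \<bar>x\<bar> \<or> b \<le> c"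
    using insert_letter_FalseD[of "run ys" b x] snoc.prems run by auto
  then show ?case
  proof cases
    case 1
    then have b: "b \<in> fst ` set (run ys)" by force
    from a show ?thesis
    proof
      assume "(a, True) \<in> set (run ys)"
      from snoc.IH[OF ys(1,2) this 1 snoc.prems(5)] old show ?thesis by blast
    next
      assume "a = nat \<bar>x\<bar> \<and> x > 0"
      then show ?thesis using snoc.prems(5) by (intro new[OF b]) auto
    qed
  next
    case 2
    then have "a \<in> fst ` set (run ys)" using a by force
    then show ?thesis using insertable_pos[OF ys(3), of a] 2 snoc.prems(5) by simp
  next
    case 3
    have "x > 0 \<and> a \<le> nat \<bar>x\<bar>"
    proof (cases "a = nat \<bar>x\<bar> \<and> x > 0")
      case False
      then have m: "(a, True) \<in> set (run ys)" using a by auto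
      then have "a \<in> fst ` set (run ys)" by force
      moreover from this have "a \<noteq> nat \<bar>x\<bar>" using run_fresh[OF snoc.prems(1)] by metis
      moreover have "a \<le> nat \<bar>x\<bar>" using 3(3) m snoc.prems(5) by auto
      ultimately show ?thesis using insertable_pos[OF ys(3), of a] by simp
    qed simp
    moreover have "b \<in> fst ` set (run ys)" using 3(2) by force
    ultimately show ?thesis using 3(1) by (intro new) auto
  qed
qed simp

lemma word_321_append: "word_321 ys \<Longrightarrow> word_321 (ys @ zs)"
  unfolding word_321_def
proof (elim disjE exE conjE)
  fix i j assume "i < j" "j < length ys" "\<bar>ys ! i\<bar> < - ys ! j"
  then show "(\<exists>i j. i < j \<and> j < length (ys @ zs) \<and> \<bar>(ys @ zs) ! i\<bar> < - (ys @ zs) ! j) \<or>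
    (\<exists>i j l. i < j \<and> j < l \<and> l < length (ys @ zs) \<and> (ys @ zs) ! j < \<bar>(ys @ zs) ! i\<bar> \<and> \<bar>(ys @ zs) ! l\<bar> < (ys @ zs) ! j)"
    by (intro disjI1 exI[of _ i] exI[of _ j]) (auto simp: nth_append)
next
  fix i j l assume "i < j" "j < l" "l < length ys" "ys ! j < \<bar>ys ! i\<bar>" "\<bar>ys ! l\<bar> < ys ! j"
  then show "(\<exists>i j. i < j \<and> j < length (ys @ zs) \<and> \<bar>(ys @ zs) ! i\<bar> < - (ys @ zs) ! j) \<or>
    (\<exists>i j l. i < j \<and> j < l \<and> l < length (ys @ zs) \<and> (ys @ zs) ! j < \<bar>(ys @ zs) ! i\<bar> \<and> \<bar>(ys @ zs) ! l\<bar> < (ys @ zs) ! j)"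
    by (intro disjI2 exI[of _ i] exI[of _ j] exI[of _ l]) (auto simp: nth_append)
qed

text \<open>At the first letter that cannot be inserted, the two ways to fail match the two
  patterns: a negative letter exceeding an existing label in absolute value ends a pair, and a U
  before a D above \<open>\<bar>x\<bar>\<close> supplies the first two entries of a triple.\<close>

lemma word_321_if_not_runnable: "signed_letters ys \<Longrightarrow> \<not> runnable ys \<Longrightarrow> word_321 ys"
proof (induction ys rule: rev_induct)
  case (snoc x ys)
  have ys: "signed_letters ys" using snoc.prems by simp
  note run = run_labels[OF ys]
  show ?case
  proof (cases "runnable ys")
    case False
    then show ?thesis using snoc.IH ys by (simp add: word_321_append)
  next
    case True
    have sorted: "sorted_labels (above (nat \<bar>x\<bar>) (run ys))"
      using run by (auto simp: sorted_labels_def above_def sorted_wrt_map intro: sorted_wrt_filter)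
    have "\<not> insertable x (run ys)" using True snoc.prems by simp
    then consider "\<not> x > 0" "below (nat \<bar>x\<bar>) (run ys) \<noteq> []" | "\<not> downs_ups (above (nat \<bar>x\<bar>) (run ys))"
      by (auto simp: insertable_def)
    then show ?thesis
    proof cases
      case 1
      then obtain b where "b \<in> fst ` set (run ys)" "b < nat \<bar>x\<bar>"
        by (auto simp: below_def filter_empty_conv)
      then obtain i where "i < length ys" "\<bar>ys ! i\<bar> < \<bar>x\<bar>" using run by (auto simp: in_set_conv_nth)
      then have "\<exists>i j. i < j \<and> j < length (ys @ [x]) \<and> \<bar>(ys @ [x]) ! i\<bar> < - (ys @ [x]) ! j"
        using 1 by (intro exI[of _ i] exI[of _ "length ys"]) (auto simp: nth_append)
      then show ?thesis by (simp only: word_321_def simp_thms)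
    next
      case 2
      then obtain a b where "(a, True) \<in> set (run ys)" "(b, False) \<in> set (run ys)" "nat \<bar>x\<bar> < a" "a < b"
        using not_downs_ups[OF sorted] by (auto simp: above_def)
      then obtain i j where "i < j" "j < length ys" "\<bar>x\<bar> < ys ! j" "ys ! j < \<bar>ys ! i\<bar>"
        using run_descent[OF ys True, of a b] by force
      then have "\<exists>i j l. i < j \<and> j < l \<and> l < length (ys @ [x]) \<and> (ys @ [x]) ! j < \<bar>(ys @ [x]) ! i\<bar> \<and>
          \<bar>(ys @ [x]) ! l\<bar> < (ys @ [x]) ! j"
        by (intro exI[of _ i] exI[of _ j] exI[of _ "length ys"]) (auto simp: nth_append)
      then show ?thesis by (simp only: word_321_def simp_thms)
    qed
  qed
qed simp

text \<open>An insertable letter must exceed \<open>a\<close> in absolute value, for otherwise a U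
  precedes a D above it. Then \<open>a\<close> lies below it and is left alone, and no insertion
  turns a D into a U.\<close>

lemma run_blocked:
  assumes "signed_letters (us @ vs)" "runnable (us @ vs)" "(a, True) \<in> set (run us)"
    "(b, False) \<in> set (run us)" "a < b"
  shows "(a, True) \<in> set (run (us @ vs)) \<and> (b, False) \<in> set (run (us @ vs)) \<and> (\<forall>x\<in>set vs. int a < \<bar>x\<bar>)"
  using assms(1,2)
proof (induction vs rule: rev_induct)
  case (snoc x vs)
  have s: "signed_letters (us @ vs)" "signed_letters ((us @ vs) @ [x])" and r: "runnable (us @ vs)"
    and i: "insertable x (run (us @ vs))" 
    using snoc.prems signed_letters_snoc[of "us @ vs" x] runnable_snoc[of "us @ vs" x] by auto
  have IH: "(a, True) \<in> set (run (us @ vs))" "(b, False) \<in> set (run (us @ vs))" "\<forall>x\<in>set vs. int a < \<bar>x\<bar>"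
    using snoc.IH[OF s(1) r] by auto
  have fresh: "nat \<bar>x\<bar> \<notin> fst ` set (run (us @ vs))" by (rule run_fresh[OF s(2)])
  have ne: "a \<noteq> nat \<bar>x\<bar>" "b \<noteq> nat \<bar>x\<bar>" using fresh IH by force+
  have less: "a < nat \<bar>x\<bar>"
    using insertable_less[OF _ i IH(1,2) assms(5) ne(1)] run_labels[OF s(1)] by auto
  have "run (us @ vs @ [x]) = insert_letter x (run (us @ vs))"
    using run_simps(2)[of "us @ vs" x] by simp
  then show ?case
    using insert_letter_True[OF IH(1) less] insert_letter_False[OF IH(2) ne(2)] IH(3) less by auto
qed (use assms in auto)

lemma not_word_321_if_runnable:
  assumes s: "signed_letters ys" and r: "runnable ys"
  shows "\<not> word_321 ys"
proof
  have ins: "insertable (ys ! j) (run (take j ys))" if "j < length ys" for j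
    using r that id_take_nth_drop[OF that] unfolding runnable_def by blast
  have st: "signed_letters (take j ys)" for j
    using s by (auto simp: signed_letters_def take_map[symmetric] dest: in_set_takeD)
  have rt: "runnable (take j ys)" for j
    using r unfolding runnable_def by (metis append.assoc append_Cons append_take_drop_id)
  assume "word_321 ys"
  then show False
    unfolding word_321_def
  proof (elim disjE exE conjE)
    fix i j assume ij: "i < j" "j < length ys" "\<bar>ys ! i\<bar> < - ys ! j"
    then have "ys ! i \<in> set (take j ys)"
      by (metis in_set_conv_nth length_take min_less_iff_conj nth_take order_less_trans)
    then have "nat \<bar>ys ! i\<bar> \<in> fst ` set (run (take j ys))"
      using run_labels[OF st[of j]] by auto
    then show False using insertable_pos[OF ins[OF ij(2)], of "nat \<bar>ys ! i\<bar>"] ij by linarith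
  next
    fix i j l
    assume ijl: "i < j" "j < l" "l < length ys" "ys ! j < \<bar>ys ! i\<bar>" "\<bar>ys ! l\<bar> < ys ! j"
    \<comment> \<open>The positive letter \<open>ys ! j\<close> enters as U at \<open>a\<close>. As
      the larger label \<open>\<bar>ys ! i\<bar>\<close> is present, some label above
      \<open>a\<close> is D afterwards, though not necessarily that one. This pair then blocks
      \<open>ys ! l\<close>.\<close>
    define a where "a = nat (ys ! j)"
    have a: "ys ! j = int a" "nat \<bar>ys ! j\<bar> = a" using ijl by (auto simp: a_def)
    have take: "take (Suc j) ys = take j ys @ [ys ! j]"
      using ijl by (intro take_Suc_conv_app_nth) auto
    have "ys ! i \<in> set (take j ys)"
      using ijl by (metis in_set_conv_nth length_take min_less_iff_conj nth_take order_less_trans)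
    then have "nat \<bar>ys ! i\<bar> \<in> fst ` set (run (take j ys))"
      using run_labels[OF st[of j]] by auto
    then obtain b where b: "a < b" "(b, False) \<in> set (run (take (Suc j) ys))"
      using insert_letter_has_False[of "nat \<bar>ys ! i\<bar>" "run (take j ys)" "ys ! j"] ijl(4) a
      unfolding take run_simps by (metis nat_int zless_nat_conj zless_nat_eq_int_zless)
    have "(a, True) \<in> set (run (take (Suc j) ys))"
      using a ijl by (auto simp: take insert_letter_def)
    moreover have "take (Suc l) ys = take (Suc j) ys @ drop (Suc j) (take (Suc l) ys)"
      using ijl by (metis append_take_drop_id min.absorb1 Suc_le_mono less_imp_le take_take)
    moreover have "ys ! l \<in> set (drop (Suc j) (take (Suc l) ys))"
      using ijl by (auto simp: in_set_conv_nth intro!: exI[of _ "l - Suc j"])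
    ultimately have "int a < \<bar>ys ! l\<bar>"
      using run_blocked[of "take (Suc j) ys" "drop (Suc j) (take (Suc l) ys)" a b] st[of "Suc l"] rt[of "Suc l"] b
      by auto
    then show False using ijl a by simp
  qed
qed

lemma runnable_iff: "signed_letters ys \<Longrightarrow> runnable ys \<longleftrightarrow> \<not> word_321 ys"
  using word_321_if_not_runnable not_word_321_if_runnable by blast

section \<open>Inverting the insertion\<close>

lemma levels_downs: "\<forall>q\<in>set d. \<not> snd q \<Longrightarrow> levels m (map snd d) = m - length d"
  by (induction d arbitrary: m) (auto simp: lev_def)

lemma levels_ups: "\<forall>q\<in>set d. snd q \<Longrightarrow> levels m (map snd d) = m + length d"
  by (induction d arbitrary: m) (auto simp: lev_def)

lemma flip_first_downs: "\<forall>q\<in>set d. \<not> snd q \<Longrightarrow> flip_first d = d"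
  by (induction d rule: flip_first.induct) auto

lemma flip_first_downs_ups: "\<forall>q\<in>set d. \<not> snd q \<Longrightarrow> flip_first (d @ (y, True) # us) = d @ (y, False) # us"
  by (induction d rule: flip_first.induct) auto

lemma downs_ups_downs: "\<forall>q\<in>set d. \<not> snd q \<Longrightarrow> downs_ups d"
  by (induction d rule: downs_ups.induct) auto

lemma downs_ups_append: "\<forall>q\<in>set d. \<not> snd q \<Longrightarrow> downs_ups (d @ (y, True) # us) \<longleftrightarrow> (\<forall>q\<in>set us. snd q)"
  by (induction d rule: downs_ups.induct) (auto simp: list_all_iff)

lemma downs_ups_cases:
  assumes "downs_ups xs"
  obtains "\<forall>q\<in>set xs. \<not> snd q"
  | d y us where "xs = d @ (y, True) # us" "\<forall>q\<in>set d. \<not> snd q" "\<forall>q\<in>set us. snd q"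
proof (cases "\<exists>q\<in>set xs. snd q")
  case True
  then obtain d q us where "xs = d @ q # us" "snd q" "\<forall>q\<in>set d. \<not> snd q"
    using split_list_first_prop by metis
  moreover from this obtain y where "q = (y, True)" by (cases q) auto
  ultimately show ?thesis using that(2) assms downs_ups_append by metis
next
  case False
  then show ?thesis using that(1) by blast
qed

text \<open>After the inserted letter the new level exceeds the old one by one, or both are 0, and
  every D keeps this relation. With nothing to flip it persists to the end. At a flipped letter the
  old level goes up and the new one down, after which the new level is exactly one below the
  old.\<close>

lemma insertable_cases:
  assumes "sorted_labels xs" "nat \<bar>x\<bar> \<notin> fst ` set xs" "insertable x xs"
  obtains (no_bump) p d where "xs = p @ d" "insert_letter x xs = p @ (nat \<bar>x\<bar>, x > 0) # d"
      "\<forall>q\<in>set d. \<not> snd q" "x > 0 \<or> p = []"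
      "levels 0 (map snd xs) \<le> levels 0 (map snd (insert_letter x xs))"
      "levels 0 (map snd (insert_letter x xs)) = lev (levels 0 (map snd xs)) True \<or>
        levels 0 (map snd xs) = 0 \<and> levels 0 (map snd (insert_letter x xs)) = 0"
  | (bump) p d y us where "xs = p @ d @ (y, True) # us"
      "insert_letter x xs = p @ (nat \<bar>x\<bar>, x > 0) # d @ (y, False) # us"
      "\<forall>q\<in>set d. \<not> snd q" "\<forall>q\<in>set us. snd q" "x > 0 \<or> p = []"
      "levels 0 (map snd xs) = Suc (levels 0 (map snd (insert_letter x xs)))"
proof -
  define p u where "p = below (nat \<bar>x\<bar>) xs" and "u = above (nat \<bar>x\<bar>) xs"
  have xs: "xs = p @ u" using below_above[OF assms(1,2)] by (simp add: p_def u_def)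
  have ins: "insert_letter x xs = p @ (nat \<bar>x\<bar>, x > 0) # flip_first u"
    by (simp add: insert_letter_def p_def u_def)
  have p: "x > 0 \<or> p = []" and u: "downs_ups u" using assms(3) by (auto simp: insertable_def p_def u_def)
  define m where "m = levels 0 (map snd p)"
  have m: "x > 0 \<or> m = 0" using p by (auto simp: m_def)
  from u show ?thesis
  proof (cases rule: downs_ups_cases)
    case 1
    note f = flip_first_downs[OF 1]
    have l: "levels 0 (map snd xs) = m - length u"
      by (simp add: xs m_def levels_downs[OF 1])
    have l': "levels 0 (map snd (insert_letter x xs)) = lev m (x > 0) - length u"
      by (simp add: ins f m_def levels_downs[OF 1])
    show ?thesis
      by (rule no_bump[OF xs ins[unfolded f] 1 p]) (use m in \<open>auto simp: l l' lev_def\<close>)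
  next
    case (2 d y us)
    note f = flip_first_downs_ups[OF 2(2), of y us]
    have xs': "xs = p @ d @ (y, True) # us" using xs 2 by simp
    have ins': "insert_letter x xs = p @ (nat \<bar>x\<bar>, x > 0) # d @ (y, False) # us"
      using ins f 2 by simp
    have l: "levels 0 (map snd xs) = Suc (m - length d + length us)"
      by (simp add: xs' m_def levels_downs[OF 2(2)] levels_ups[OF 2(3)] lev_def)
    have l': "levels 0 (map snd (insert_letter x xs)) = lev m (x > 0) - length d - 1 + length us"
      by (simp add: ins' m_def levels_downs[OF 2(2)] levels_ups[OF 2(3)]) (simp add: lev_def)
    show ?thesis
      by (rule bump[OF xs' ins' 2(2,3) p]) (use m in \<open>auto simp: l l' lev_def\<close>)
  qed
qed

lemma last_split_unique:
  assumes "p @ z # d = p' @ z' # d'" "P z" "P z'" "\<forall>q\<in>set d. \<not> P q" "\<forall>q\<in>set d'. \<not> P q"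
  shows "p = p' \<and> z = z' \<and> d = d'"
  using assms by (auto simp: append_eq_append_conv2 append_eq_Cons_conv Cons_eq_append_conv)

text \<open>The inserted letter is recognisable: it is the last U if there is one, and otherwise it
  is negative and stands first.\<close>

lemma no_bump_unique:
  assumes eq: "p @ (a, s) # d = p' @ (a', s') # d'"
    and d: "\<forall>q\<in>set d. \<not> snd q" "\<forall>q\<in>set d'. \<not> snd q" and s: "s \<or> p = []" "s' \<or> p' = []"
  shows "p = p' \<and> a = a' \<and> s = s' \<and> d = d'"
proof -
  have "s \<longleftrightarrow> (\<exists>q\<in>set (p @ (a, s) # d). snd q)" using d s by auto
  moreover have "s' \<longleftrightarrow> (\<exists>q\<in>set (p' @ (a', s') # d'). snd q)" using d s by auto
  ultimately have ss: "s = s'" by (simp only: eq)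
  show ?thesis
  proof (cases s)
    case True
    then show ?thesis using last_split_unique[OF eq _ _ d] ss by simp
  next
    case False
    then show ?thesis using s ss eq by simp
  qed
qed

text \<open>Equal old levels force the same case on both sides. With a bump, the flipped letter is
  the last D, and what precedes it is decoded as without a bump.\<close>

lemma insert_letter_inj:
  assumes xs: "sorted_labels xs" "nat \<bar>x\<bar> \<notin> fst ` set xs" "insertable x xs" "x \<noteq> 0"
    and ys: "sorted_labels ys" "nat \<bar>y\<bar> \<notin> fst ` set ys" "insertable y ys" "y \<noteq> 0"
    and eq: "insert_letter x xs = insert_letter y ys" "levels 0 (map snd xs) = levels 0 (map snd ys)"
  shows "x = y \<and> xs = ys"
proof -
  have xy: "x = y" if "nat \<bar>x\<bar> = nat \<bar>y\<bar>" "(x > 0) = (y > 0)"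
    using that xs(4) ys(4) by linarith
  show ?thesis
  proof (cases rule: insertable_cases[OF xs(1-3)])
    case A: (1 p d)
    show ?thesis
    proof (cases rule: insertable_cases[OF ys(1-3)])
      case B: (1 p' d')
      have "p @ (nat \<bar>x\<bar>, x > 0) # d = p' @ (nat \<bar>y\<bar>, y > 0) # d'"
        using A(2) B(2) eq(1) by simp
      from no_bump_unique[OF this A(3) B(3) A(4) B(4)] show ?thesis using xy A(1) B(1) by simp
    next
      case B: (2 p' d' z us)
      then show ?thesis using A(5) eq by simp
    qed
  next
    case A: (2 p d z us)
    show ?thesis
    proof (cases rule: insertable_cases[OF ys(1-3)])
      case B: (1 p' d')
      then show ?thesis using A(6) eq by simp
    next
      case B: (2 p' d' z' us')
      have "(p @ (nat \<bar>x\<bar>, x > 0) # d) @ (z, False) # us = (p' @ (nat \<bar>y\<bar>, y > 0) # d') @ (z', False) # us'"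
        using A(2) B(2) eq(1) by simp
      from last_split_unique[OF this, of "\<lambda>q. \<not> snd q"] A(4) B(4)
      have *: "p @ (nat \<bar>x\<bar>, x > 0) # d = p' @ (nat \<bar>y\<bar>, y > 0) # d'" "z = z'" "us = us'"
        by auto
      from no_bump_unique[OF *(1) A(3) B(3) A(5) B(5)] show ?thesis using xy A(1) B(1) *(2,3) by simp
    qed
  qed
qed

lemma insert_letter_split:
  assumes sorted: "sorted_labels (p @ (a, s) # u)" and a: "a > 0" and s: "s \<or> p = []" 
    and u: "map fst v = map fst u" "flip_first v = u" "downs_ups v"
  defines "x \<equiv> (if s then int a else - int a)"
  shows "x \<noteq> 0" "sorted_labels (p @ v)" "nat \<bar>x\<bar> \<notin> fst ` set (p @ v)" "insertable x (p @ v)"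
    "insert_letter x (p @ v) = p @ (a, s) # u"
proof -
  have x: "nat \<bar>x\<bar> = a" "x > 0 \<longleftrightarrow> s" using a by (auto simp: x_def)
  have uv: "\<forall>q\<in>set v. \<exists>q'\<in>set u. fst q = fst q'"
    using u(1) by (metis imageE image_eqI set_map)
  have p: "\<forall>q\<in>set p. fst q < a" and v: "\<forall>q\<in>set v. a < fst q" "\<forall>q\<in>set p. \<forall>q'\<in>set v. fst q < fst q'"
    using sorted uv by (auto simp: sorted_labels_append sorted_labels_Cons) (metis fst_conv)+
  have below: "below a (p @ v) = p" and above: "above a (p @ v) = v"
    using p v by (auto simp: below_def above_def filter_empty_conv filter_id_conv)
  show "x \<noteq> 0" using a by (simp add: x_def)
  have "sorted_labels v" using sorted sorted_labels_cong[OF u(1)]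
    by (auto simp: sorted_labels_append sorted_labels_Cons)
  then show "sorted_labels (p @ v)" using sorted v by (auto simp: sorted_labels_append)
  show "nat \<bar>x\<bar> \<notin> fst ` set (p @ v)" using p v by (auto simp: x)
  show "insertable x (p @ v)" using s u by (auto simp: insertable_def x below above)
  show "insert_letter x (p @ v) = p @ (a, s) # u"
    by (simp only: insert_letter_def x below above u)
qed

lemma no_bump_split:
  assumes "xs \<noteq> []"
  obtains p a s d where "xs = p @ (a, s) # d" "\<forall>q\<in>set d. \<not> snd q" "s \<or> p = []"
proof (cases "\<exists>q\<in>set xs. snd q")
  case True
  then obtain p q d where "xs = p @ q # d" "snd q" "\<forall>q\<in>set d. \<not> snd q"
    using split_list_last_prop by metis
  then show ?thesis using that[of p "fst q" True d] by (cases q) simp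
next
  case False
  then show ?thesis using assms that[of "[]" "fst (hd xs)" "snd (hd xs)" "tl xs"]
    by (auto simp: neq_Nil_conv)
qed

text \<open>The letter \<open>q\<close> and the level \<open>m\<close> dictate how to undo the step:
  without a bump if the level rose or stayed 0, and by turning the last D back into U if it
  fell.\<close>

lemma insert_letter_surj:
  assumes L: "sorted_labels L" "0 \<notin> fst ` set L" and m: "levels 0 (map snd L) = lev m q" "m < length L"
  obtains x xs where "x \<noteq> 0" "sorted_labels xs" "nat \<bar>x\<bar> \<notin> fst ` set xs" "insertable x xs"
    "insert_letter x xs = L" "levels 0 (map snd xs) = m"
proof (cases "q \<or> m = 0")
  case True
  obtain p a s d where split: "L = p @ (a, s) # d" and d: "\<forall>q\<in>set d. \<not> snd q" and s: "s \<or> p = []"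
    using no_bump_split[of L] m(2) by (metis less_zeroE list.size(3))
  note ins = insert_letter_split[OF L(1)[unfolded split] _ s refl flip_first_downs[OF d] downs_ups_downs[OF d]]
  have a: "a > 0" using L(2) split by force
  define k where "k = levels 0 (map snd p)"
  have "levels 0 (map snd L) = lev k s - length d"
    by (simp add: split k_def levels_downs[OF d])
  moreover have "levels 0 (map snd (p @ d)) = k - length d"
    by (simp add: k_def levels_downs[OF d])
  moreover have "s \<or> k = 0" using s by (auto simp: k_def)
  ultimately have "levels 0 (map snd (p @ d)) = m"
    using True m(1) by (auto simp: lev_def split: if_splits)
  with that[OF ins[OF a, folded split]] show ?thesis by simp
next
  case False
  \<comment> \<open>A word consisting of U only has level \<open>length L\<close>, but after a
    falling step the level is \<open>m - 1\<close> with \<open>m < length L\<close>.\<close>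
  have "\<exists>q\<in>set L. \<not> snd q"
  proof (rule ccontr)
    assume "\<not> ?thesis"
    then have "levels 0 (map snd L) = length L" by (simp add: levels_ups)
    then show False using m False by (simp add: lev_def)
  qed
  then obtain r z us where r: "L = r @ z # us" "\<not> snd z" "\<forall>q\<in>set us. snd q"
    using split_list_last_prop[of L "\<lambda>q. \<not> snd q"] by auto
  then obtain y where L_r: "L = r @ (y, False) # us" by (cases z) auto
  \<comment> \<open>Something must precede the last D to serve as the inserted letter: otherwise the
    level of \<open>L\<close> is \<open>length L - 1\<close>, which forces
    \<open>m = length L\<close>.\<close>
  have "r \<noteq> []"
  proof
    assume "r = []"
    then have "levels 0 (map snd L) = length us" using L_r levels_ups[OF r(3)] by (simp add: lev_def)
    then show False using m False L_r \<open>r = []\<close> by (simp add: lev_def)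
  qed
  then obtain p a s d where r_split: "r = p @ (a, s) # d" and d: "\<forall>q\<in>set d. \<not> snd q" and s: "s \<or> p = []"
    using no_bump_split[of r] by metis
  have split: "L = p @ (a, s) # d @ (y, False) # us" using L_r r_split by simp
  have map_eq: "map fst (d @ (y, True) # us) = map fst (d @ (y, False) # us)" by simp
  note ins = insert_letter_split[OF L(1)[unfolded split] _ s map_eq flip_first_downs_ups[OF d]
      downs_ups_append[OF d, THEN iffD2, OF r(3)]]
  have a: "a > 0" using L(2) split by force
  define k where "k = levels 0 (map snd p)"
  have "levels 0 (map snd L) = lev k s - length d - 1 + length us"
    by (simp add: split k_def levels_downs[OF d] levels_ups[OF r(3)]) (simp add: lev_def)
  moreover have "levels 0 (map snd (p @ d @ (y, True) # us)) = k - length d + 1 + length us"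
    by (simp add: k_def levels_downs[OF d] levels_ups[OF r(3)]) (simp add: lev_def)
  moreover have "s \<or> k = 0" using s by (auto simp: k_def)
  ultimately have "levels 0 (map snd (p @ d @ (y, True) # us)) = m"
    using False m(1) by (auto simp: lev_def split: if_splits)
  with that[OF ins[OF a, folded split]] show ?thesis by simp
qed

section \<open>The recording tableau as a word\<close>

definition run_level :: "int list \<Rightarrow> nat" where
  "run_level ys = levels 0 (map snd (run ys))"

text \<open>\<open>False\<close> covers a falling level as well as one that stays at 0, exactly as
  in \<open>lev\<close>, so this word is the encoding of the recording tableau.\<close>

definition recording :: "int list \<Rightarrow> bool list" where
  "recording ys = map (\<lambda>k. run_level (take k ys) < run_level (take (Suc k) ys)) [0..<length ys]"

lemma length_recording [simp]: "length (recording ys) = length ys"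
  by (simp add: recording_def)

lemma recording_Nil [simp]: "recording [] = []"
  by (simp add: recording_def)

lemma recording_snoc [simp]:
  "recording (ys @ [x]) = recording ys @ [run_level ys < run_level (ys @ [x])]"
  by (simp add: recording_def)

lemma levels_recording:
  "signed_letters ys \<Longrightarrow> runnable ys \<Longrightarrow> levels 0 (recording ys) = run_level ys"
proof (induction ys rule: rev_induct)
  case (snoc x ys)
  have "run_level (ys @ [x]) = lev (run_level ys) (run_level ys < run_level (ys @ [x]))"
  proof -
    have s: "sorted_labels (run ys)" using snoc.prems run_labels by auto
    have f: "nat \<bar>x\<bar> \<notin> fst ` set (run ys)" by (rule run_fresh[OF snoc.prems(1)])
    have i: "insertable x (run ys)" using snoc.prems by simp
    show ?thesis
      by (cases rule: insertable_cases[OF s f i]) (auto simp: run_level_def lev_def)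
  qed
  with snoc show ?case by simp
qed (simp add: run_level_def)

text \<open>The recording without its last letter determines the level before the last step, and
  this makes that step invertible.\<close>

lemma run_recording_inj:
  "signed_letters ys \<Longrightarrow> runnable ys \<Longrightarrow> signed_letters zs \<Longrightarrow> runnable zs \<Longrightarrow>
    run ys = run zs \<Longrightarrow> recording ys = recording zs \<Longrightarrow> ys = zs"
proof (induction ys arbitrary: zs rule: rev_induct)
  case Nil
  then show ?case using length_recording[of zs] by simp
next
  case (snoc x ys)
  obtain z zs' where zs: "zs = zs' @ [z]"
    using snoc.prems(6) length_recording[of zs] by (cases zs rule: rev_cases) auto
  have rec: "recording ys = recording zs'" using snoc.prems(6) by (simp add: zs)
  have lv: "levels 0 (map snd (run ys)) = levels 0 (map snd (run zs'))"
    using levels_recording[of ys] levels_recording[of zs'] rec snoc.prems by (simp add: zs run_level_def)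
  have "x = z \<and> run ys = run zs'"
    by (rule insert_letter_inj[OF _ run_fresh[OF snoc.prems(1)] _ _ _ run_fresh[OF snoc.prems(3)[unfolded zs]] _ _ _ lv])
      (use snoc.prems run_labels in \<open>auto simp: zs\<close>)
  with snoc.IH[of zs'] rec snoc.prems show ?case by (simp add: zs)
qed

lemma exists_run:
  "sorted_labels L \<Longrightarrow> 0 \<notin> fst ` set L \<Longrightarrow> length qs = length L \<Longrightarrow> levels 0 qs = levels 0 (map snd L) \<Longrightarrow>
    \<exists>ys. signed_letters ys \<and> runnable ys \<and> run ys = L \<and> recording ys = qs"
proof (induction qs arbitrary: L rule: rev_induct)
  case Nil
  then show ?case by (intro exI[of _ "[]"]) (simp add: signed_letters_def)
next
  case (snoc q qs)
  define m where "m = levels 0 qs"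
  have m: "levels 0 (map snd L) = lev m q" using snoc.prems(4) by (simp add: m_def)
  have "m \<le> length qs" using levels_le[of 0 0 qs] by (simp add: m_def)
  then have "m < length L" using snoc.prems(3) by simp
  then obtain x xs where x: "x \<noteq> 0" "sorted_labels xs" "nat \<bar>x\<bar> \<notin> fst ` set xs" "insertable x xs"
    and L: "insert_letter x xs = L" and lv: "levels 0 (map snd xs) = m"
    using insert_letter_surj[OF snoc.prems(1,2) m] by metis
  have len: "length xs = length qs"
    using length_insert_letter[OF x(2,3)] L snoc.prems(3) by simp
  have labels: "fst ` set L = insert (nat \<bar>x\<bar>) (fst ` set xs)"
    using labels_insert_letter[OF x(2,3)] L by simp
  obtain ys where ys: "signed_letters ys" "runnable ys" "run ys = xs" "recording ys = qs"
    using snoc.IH[OF x(2)] labels snoc.prems(2) len lv m_def by auto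
  have "\<bar>x\<bar> \<notin> abs ` set ys"
  proof
    assume "\<bar>x\<bar> \<in> abs ` set ys"
    then have "nat \<bar>x\<bar> \<in> (\<lambda>x. nat \<bar>x\<bar>) ` set ys" by force
    then show False using run_labels[OF ys(1)] ys(3) x(3) by simp
  qed
  then have sig: "signed_letters (ys @ [x])" using ys x by simp
  have lv': "run_level ys = m" "run_level (ys @ [x]) = lev m q"
    using ys lv L m by (simp_all add: run_level_def)
  have "(m < lev m q) = q" by (cases q) (simp_all add: lev_def)
  then have "recording (ys @ [x]) = qs @ [q]" using ys(4) lv' by simp
  then show ?case using sig ys x L by (intro exI[of _ "ys @ [x]"]) simp
qed

section \<open>Standard domino tableaux with at most two rows\<close>

lemma two_rows_inj: "m \<le> c \<Longrightarrow> m' \<le> c \<Longrightarrow> two_rows c m = two_rows c m' \<Longrightarrow> m = m'"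
proof -
  assume m: "m \<le> c" "m' \<le> c" and eq: "two_rows c m = two_rows c m'"
  have "{l. (1, l) \<in> two_rows c k} = {1..c + k}" for k
    by (auto simp: two_rows_def)
  then have "{1..c + m} = {1..c + m'}" using eq by metis
  then have "card {1..c + m} = card {1..c + m'}" by (rule arg_cong)
  then show "m = m'" by simp
qed

lemma two_rows_partition:
  assumes "m \<le> c"
  obtains p where "is_partition p" "length p \<le> 2" "sum_list p = 2 * c" "two_rows c m = young_diagram p"
proof -
  consider "c = 0" | "c > 0" "m = c" | "m < c" using assms by linarith
  then show ?thesis
  proof cases
    case 1
    show ?thesis by (rule that[of "[]"])
      (use 1 assms in \<open>auto simp: is_partition_def young_diagram_def two_rows_def\<close>)
  next
    case 2
    show ?thesis by (rule that[of "[c + m]"])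
      (use 2 in \<open>auto simp: is_partition_def young_diagram_def two_rows_def\<close>)
  next
    case 3
    show ?thesis
    proof (rule that[of "[c + m, c - m]"])
      show "two_rows c m = young_diagram [c + m, c - m]"
      proof (intro set_eqI, clarify)
        fix k l :: nat
        consider "k = 0" | "k = 1" | "k = 2" | "k \<ge> 3" by linarith
        then show "(k, l) \<in> two_rows c m \<longleftrightarrow> (k, l) \<in> young_diagram [c + m, c - m]"
          by cases (auto simp: young_diagram_def two_rows_def)
      qed
    qed (use 3 in \<open>auto simp: is_partition_def\<close>)
  qed
qed

lemma at_most_two_rows_two_rows: "m \<le> c \<Longrightarrow> at_most_two_rows (two_rows c m)"
  using two_rows_partition[of m c] by (auto simp: at_most_two_rows_def)

lemma at_most_two_rows_not_reaches_row_three: "at_most_two_rows D \<Longrightarrow> \<not> reaches_row_three D"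
  by (auto simp: at_most_two_rows_def reaches_row_three_def young_diagram_def)

definition std_tab :: "bool list \<Rightarrow> tableau" where
  "std_tab us = tab (zip [1..<Suc (length us)] us)"

lemma sorted_labels_zip: "sorted_labels (zip [1..<Suc (length us)] us)"
  by (simp add: sorted_labels_def del: upt_Suc)

lemma shape_std_tab: "shape (std_tab us) = two_rows (length us) (levels 0 us)"
  using shape_tab[OF sorted_labels_distinct[OF sorted_labels_zip]] by (simp add: std_tab_def del: upt_Suc)

lemma std_tab_eqI:
  assumes "sorted_labels xs" "fst ` set xs = {1..n}"
  shows "length xs = n" "tab xs = std_tab (map snd xs)" "xs = zip [1..<Suc n] (map snd xs)"
proof -
  have "map fst xs = [1..<Suc n]"
  proof (rule sorted_distinct_set_unique)
    show "set (map fst xs) = set [1..<Suc n]" using assms by auto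
  qed (use assms(1) in \<open>auto simp: sorted_labels_def strict_sorted_iff simp del: upt_Suc\<close>)
  then show *: "length xs = n" "xs = zip [1..<Suc n] (map snd xs)"
    by (metis diff_Suc_1 length_map length_upt, metis zip_map_fst_snd)
  then show "tab xs = std_tab (map snd xs)" by (simp add: std_tab_def del: upt_Suc)
qed

lemma std_tab_Nil: "std_tab [] = Map.empty"
  by (simp add: std_tab_def tab_def)

lemma std_tab_snoc:
  "std_tab (us @ [u]) = (std_tab us)(Suc (length us) \<mapsto> two_row_domino (length us) (levels 0 us) u)"
proof -
  let ?ds = "dominoes 0 0 (zip [1..<Suc (length us)] us)"
  have upt: "[1..<Suc (Suc (length us))] = [1..<Suc (length us)] @ [Suc (length us)]"
    by (simp add: upt_Suc_append del: upt_Suc)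
  have "std_tab (us @ [u]) = map_of (?ds @ [(Suc (length us), two_row_domino (length us) (levels 0 us) u)])"
    by (simp add: std_tab_def tab_def dominoes_append upt del: map_of_append upt_Suc One_nat_def)
  moreover have "map_of ?ds (Suc (length us)) = None"
    by (auto simp: map_of_eq_None_iff dest: set_zip_leftD simp del: upt_Suc)
  ultimately show ?thesis
    by (auto simp: std_tab_def tab_def map_add_def fun_eq_iff simp del: upt_Suc split: option.split)
qed

lemma dom_std_tab: "dom (std_tab us) = {1..length us}"
proof (induction us rule: rev_induct)
  case (snoc u us)
  have "dom (S(a \<mapsto> b)) = insert a (dom S)" for S :: tableau and a b by (auto split: if_splits)
  then show ?case using snoc by (simp only: std_tab_snoc) auto
qed (simp add: std_tab_Nil)

lemma std_tab_lookup:
  "k < length us \<Longrightarrow> std_tab us (Suc k) = Some (two_row_domino k (levels 0 (take k us)) (us ! k))"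
proof (induction us rule: rev_induct)
  case (snoc u us)
  then show ?case by (cases "k = length us") (auto simp: std_tab_snoc nth_append)
qed simp

text \<open>The letter is visible in the cells: a D domino, vertical or horizontal, meets row two
  and a U domino never does.\<close>

lemma two_row_domino_eq_iff: "two_row_domino c m u = two_row_domino c m v \<longleftrightarrow> u = v"
proof -
  have *: "(\<exists>l. (2::nat, l) \<in> two_row_domino c m u) \<longleftrightarrow> \<not> u" for u
    by (auto simp: two_row_domino_def hdomino_def vdomino_def)
  show ?thesis using *[of u] *[of v] by (cases "u = v") auto
qed

lemma std_tab_inj: "std_tab us = std_tab vs \<Longrightarrow> us = vs"
proof -
  assume eq: "std_tab us = std_tab vs"
  then have len: "length us = length vs"
    using dom_std_tab[of us] dom_std_tab[of vs] by (metis card_atLeastAtMost diff_Suc_1)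
  have "k \<le> length us \<Longrightarrow> take k us = take k vs" for k
  proof (induction k)
    case (Suc k)
    then have "us ! k = vs ! k"
      using std_tab_lookup[of k us] std_tab_lookup[of k vs] eq len two_row_domino_eq_iff by auto
    then show ?case using Suc len by (simp add: take_Suc_conv_app_nth)
  qed simp
  from this[of "length us"] show ?thesis using len by simp
qed

lemma is_domino_two_row_domino: "is_domino (two_row_domino c m u)"
  by (auto simp: two_row_domino_def is_domino_def)

lemma two_rows_down_closed:
  assumes "m \<le> c" "(k', l') \<in> two_rows c m" "1 \<le> k" "k \<le> k'" "1 \<le> l" "l \<le> l'"
  shows "(k, l) \<in> two_rows c m"
  using assms by (auto simp: two_rows_def)

lemma std_tab_subset:
  assumes "i < j" "j \<le> length us" "i \<in> dom (std_tab us)"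
  shows "the (std_tab us i) \<subseteq> two_rows i (levels 0 (take i us))"
    and "the (std_tab us j) \<inter> two_rows i (levels 0 (take i us)) = {}"
proof -
  have le: "levels 0 (take k us) \<le> k" if "k \<le> length us" for k
    using levels_le[of 0 0 "take k us"] that by simp
  have step: "two_rows (Suc k) (levels 0 (take (Suc k) us)) =
      two_rows k (levels 0 (take k us)) \<union> two_row_domino k (levels 0 (take k us)) (us ! k)" if "k < length us" for k
    using two_rows_step[OF le, of k "us ! k"] that by (simp add: take_Suc_conv_app_nth)
  have mono: "two_rows i (levels 0 (take i us)) \<subseteq> two_rows k (levels 0 (take k us))" if "i \<le> k" "k \<le> length us" for k
    using that
  proof (induction k rule: dec_induct)
    case (step k)
    then show ?case using \<open>\<And>k. k < length us \<Longrightarrow> _\<close>[of k] by auto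
  qed simp
  obtain i' j' where ij: "i = Suc i'" "j = Suc j'" using assms by (cases i; cases j) (auto simp: dom_std_tab)
  show "the (std_tab us i) \<subseteq> two_rows i (levels 0 (take i us))"
    using step[of i'] assms by (simp add: ij std_tab_lookup)
  show "the (std_tab us j) \<inter> two_rows i (levels 0 (take i us)) = {}"
    using mono[of j'] two_row_domino_disjoint[OF le, of j' "us ! j'"] assms by (auto simp: ij std_tab_lookup)
qed

lemma standard_std_tab:
  assumes "length us = n" shows "standard_domino_tableau n (std_tab us)"
proof -
  let ?T = "std_tab us"
  have le: "levels 0 (take k us) \<le> k" if "k \<le> n" for k
    using levels_le[of 0 0 "take k us"] that assms by simp
  have dom: "dom ?T = {1..n}" using assms by (simp add: dom_std_tab)
  have disj: "the (?T i) \<inter> the (?T j) = {}" if "i \<in> dom ?T" "j \<in> dom ?T" "i < j" for i j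
    using std_tab_subset[of i j us] that assms dom by fastforce
  have pos: "1 \<le> k" "1 \<le> l" if i: "i \<in> dom ?T" "(k, l) \<in> the (?T i)" for i k l
  proof -
    obtain i' where "i = Suc i'" "i' < length us" using i(1) dom assms by (cases i) auto
    then show "1 \<le> k" "1 \<le> l"
      using i(2) by (auto simp: std_tab_lookup two_row_domino_def hdomino_def vdomino_def split: if_splits)
  qed
  \<comment> \<open>Monotonicity in both coordinates at once covers the row and the column
    condition. If \<open>j < i\<close>, the cell of \<open>j\<close> lies in the diagram filled by
    the labels up to \<open>j\<close>, and down-closure would put the cell of \<open>i\<close> there
    too.\<close>
  have incr: "i \<le> j" if ij: "i \<in> dom ?T" "j \<in> dom ?T" and c: "(k, l) \<in> the (?T i)" "(k', l') \<in> the (?T j)" "k \<le> k'" "l \<le> l'"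
    for i j k l k' l'
  proof (rule ccontr)
    assume "\<not> i \<le> j"
    then have ji: "j < i" by simp
    have "(k', l') \<in> two_rows j (levels 0 (take j us))"
      using std_tab_subset(1)[of j i us] ji ij c dom assms by auto
    then have "(k, l) \<in> two_rows j (levels 0 (take j us))"
      using two_rows_down_closed[OF le] pos[OF ij(1) c(1)] c ij dom by auto
    then show False using std_tab_subset(2)[of j i us] ji ij c dom assms by auto
  qed
  have "\<exists>p. is_partition p \<and> sum_list p = 2 * n \<and> shape ?T = young_diagram p"
    using two_rows_partition[of "levels 0 us" n] le[of n] assms by (metis order_refl shape_std_tab take_all)
  moreover have "is_domino d" if d: "d \<in> ran ?T" for d
  proof -
    obtain i where i: "?T i = Some d" using d by (auto simp: ran_def)
    then have "i \<in> {1..n}" using dom by blast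
    then obtain i' where "i = Suc i'" "i' < length us" using assms by (cases i) auto
    then show ?thesis using i by (auto simp: std_tab_lookup is_domino_two_row_domino)
  qed
  moreover have "\<forall>i\<in>dom ?T. \<forall>j\<in>dom ?T. i \<noteq> j \<longrightarrow> the (?T i) \<inter> the (?T j) = {}"
    using disj by (metis inf_commute linorder_neqE_nat)
  ultimately show ?thesis
    unfolding standard_domino_tableau_def using dom incr by (intro conjI) (blast intro: order_refl)+
qed

section \<open>Decoding standard tableaux with at most two rows\<close>

lemma young_diagram_down_closed:
  assumes "is_partition p" "(k', l') \<in> young_diagram p" "1 \<le> k" "k \<le> k'" "1 \<le> l" "l \<le> l'"
  shows "(k, l) \<in> young_diagram p"
proof -
  have "p ! (k' - 1) \<le> p ! (k - 1)" if "k \<noteq> k'"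
    using assms that sorted_wrt_nth_less[of "(\<ge>)" p "k - 1" "k' - 1"]
    by (auto simp: is_partition_def young_diagram_def)
  then show ?thesis using assms by (cases "k = k'") (auto simp: young_diagram_def)
qed

text \<open>Disjointness bounds the column \<open>l\<close> from below and \<open>closed\<close>
  bounds it from above, which leaves only the three dominoes that extend the diagram.\<close>

lemma domino_extension:
  assumes m: "m \<le> c" and d: "is_domino d" "d \<inter> two_rows c m = {}"
    and rows: "\<forall>(k, l)\<in>d. 1 \<le> k \<and> k \<le> 2 \<and> 1 \<le> l"
    and closed: "\<And>k l k' l'. (k', l') \<in> d \<Longrightarrow> 1 \<le> k \<Longrightarrow> k \<le> k' \<Longrightarrow> 1 \<le> l \<Longrightarrow> l \<le> l' \<Longrightarrow> (k, l) \<in> two_rows c m \<union> d"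
  shows "\<exists>u. d = two_row_domino c m u"
proof -
  obtain k l where kl: "d = hdomino k l \<or> d = vdomino k l" using d(1) by (auto simp: is_domino_def)
  then have "(k, l) \<in> d" by (auto simp: hdomino_def vdomino_def)
  then have "1 \<le> k" "k \<le> 2" "1 \<le> l" using rows by auto
  moreover have "k + 1 \<le> 2" if "d = vdomino k l"
    using rows that by (simp add: vdomino_def)
  ultimately consider "d = hdomino 1 l" "1 \<le> l" | "d = hdomino 2 l" "1 \<le> l" | "d = vdomino 1 l" "1 \<le> l"
    using kl by (cases "k = 1") (auto simp: numeral_2_eq_2 le_Suc_eq)
  then show ?thesis
  proof cases
    case 1
    then have "c + m < l" using d(2) by (auto simp: hdomino_def two_rows_def)
    moreover have "l \<le> c + m + 1"
    proof (rule ccontr)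
      assume l: "\<not> ?thesis"
      then have "(1, l - 1) \<in> two_rows c m \<union> d"
        using 1 by (intro closed[of 1 l]) (auto simp: hdomino_def)
      then show False using 1 l by (auto simp: hdomino_def two_rows_def)
    qed
    ultimately have "l = c + m + 1" by simp
    then have "d = two_row_domino c m True" using 1 by (simp add: two_row_domino_def)
    then show ?thesis by blast
  next
    case 2
    then have "c - m < l" using d(2) by (auto simp: hdomino_def two_rows_def)
    moreover have "l \<le> c - m + 1"
    proof (rule ccontr)
      assume l: "\<not> ?thesis"
      then have "(2, l - 1) \<in> two_rows c m \<union> d"
        using 2 by (intro closed[of 2 l]) (auto simp: hdomino_def)
      then show False using 2 l by (auto simp: hdomino_def two_rows_def)
    qed
    \<comment> \<open>The cell above the right end of the domino must be filled, so the first row is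
      at least two longer. This gives \<open>m \<noteq> 0\<close>, where the letter D means a
      horizontal domino.\<close>
    moreover have "l + 1 \<le> c + m"
      using closed[of 2 "l + 1" 1 "l + 1"] 2 by (auto simp: hdomino_def two_rows_def)
    ultimately have "l = c - m + 1" "m \<noteq> 0" by auto
    then have "d = two_row_domino c m False" using 2 by (simp add: two_row_domino_def)
    then show ?thesis by blast
  next
    case 3
    then have "c + m < l" using d(2) by (auto simp: vdomino_def two_rows_def)
    moreover have "l \<le> c - m + 1"
    proof (rule ccontr)
      assume l: "\<not> ?thesis"
      then have "(2, l - 1) \<in> two_rows c m \<union> d"
        using 3 by (intro closed[of 2 l]) (auto simp: vdomino_def)
      then show False using 3 l by (auto simp: vdomino_def two_rows_def)
    qed
    ultimately have "l = c + 1" "m = 0" by auto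
    then have "d = two_row_domino c m False" using 3 by (simp add: two_row_domino_def)
    then show ?thesis by blast
  qed
qed

lemma standard_two_rows:
  assumes std: "standard_domino_tableau n S" and rows: "at_most_two_rows (shape S)"
  obtains us where "length us = n" "S = std_tab us"
proof -
  have dom: "dom S = {1..n}" 
    and domino: "\<And>i. i \<in> dom S \<Longrightarrow> is_domino (the (S i))"
    and disj: "\<And>i j. i \<in> dom S \<Longrightarrow> j \<in> dom S \<Longrightarrow> i \<noteq> j \<Longrightarrow> the (S i) \<inter> the (S j) = {}"
    and row: "\<And>i j k l l'. i \<in> dom S \<Longrightarrow> j \<in> dom S \<Longrightarrow> (k, l) \<in> the (S i) \<Longrightarrow> (k, l') \<in> the (S j) \<Longrightarrow> l \<le> l' \<Longrightarrow> i \<le> j"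
    and col: "\<And>i j k k' l. i \<in> dom S \<Longrightarrow> j \<in> dom S \<Longrightarrow> (k, l) \<in> the (S i) \<Longrightarrow> (k', l) \<in> the (S j) \<Longrightarrow> k \<le> k' \<Longrightarrow> i \<le> j"
    using std unfolding standard_domino_tableau_def by (simp_all add: ran_def dom_def) (blast | fastforce)+
  obtain p where p: "is_partition p" "length p \<le> 2" "shape S = young_diagram p"
    using rows by (auto simp: at_most_two_rows_def)
  have cell: "(k, l) \<in> shape S \<longleftrightarrow> (\<exists>i\<in>dom S. (k, l) \<in> the (S i))" for k l
    by (force simp: shape_def ran_def dom_def)
  have "\<exists>us. length us = k \<and> S |` {1..k} = std_tab us" if "k \<le> n" for k
    using that
  proof (induction k)
    case 0
    then show ?case by (intro exI[of _ "[]"]) (auto simp: std_tab_Nil restrict_map_def)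
  next
    case (Suc k)
    then obtain us where us: "length us = k" "S |` {1..k} = std_tab us" by auto
    let ?Y = "two_rows k (levels 0 us)"
    have m: "levels 0 us \<le> k" using levels_le[of 0 0 us] us by simp
    have Y: "?Y = shape (S |` {1..k})" using shape_std_tab[of us] us by simp
    have in_Y: "q \<in> ?Y \<longleftrightarrow> (\<exists>i\<in>{1..k}. q \<in> the (S i))" for q
    proof -
      have S: "S i = Some (the (S i))" if "i \<in> {1..k}" for i
      proof -
        have "i \<in> dom S" using that dom Suc.prems by simp
        then show ?thesis by auto
      qed
      have "q \<in> ?Y \<longleftrightarrow> (\<exists>i d. (S |` {1..k}) i = Some d \<and> q \<in> d)"
        unfolding Y shape_def ran_def by blast
      also have "\<dots> \<longleftrightarrow> (\<exists>i\<in>{1..k}. q \<in> the (S i))"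
        unfolding restrict_map_def using S by (metis option.distinct(1) option.sel)
      finally show ?thesis .
    qed
    let ?d = "the (S (Suc k))"
    have k: "Suc k \<in> dom S" using dom Suc.prems by simp
    have "\<exists>u. ?d = two_row_domino k (levels 0 us) u"
    proof (rule domino_extension[OF m domino[OF k]])
      show "?d \<inter> ?Y = {}"
        using disj[OF k] dom Suc.prems in_Y by fastforce
      have sub: "(r, l) \<in> young_diagram p" if "(r, l) \<in> ?d" for r l
        using cell k p(3) that by blast
      show "\<forall>(r, l)\<in>?d. 1 \<le> r \<and> r \<le> 2 \<and> 1 \<le> l"
        using sub p(2) by (fastforce simp: young_diagram_def)
      fix r l r' l' assume *: "(r', l') \<in> ?d" "1 \<le> r" "r \<le> r'" "1 \<le> l" "l \<le> l'"
      note sub[OF *(1)]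
      \<comment> \<open>The corner \<open>(r', l)\<close> links the two cells: the column condition
        gives \<open>j \<le> i\<close> and the row condition \<open>i \<le> Suc k\<close>, so the
        label at \<open>(r, l)\<close> is at most \<open>Suc k\<close>.\<close>
      then have "(r', l) \<in> shape S" "(r, l) \<in> shape S"
        using young_diagram_down_closed[OF p(1), of r' l'] * by (auto simp: p(3))
      then obtain i j where i: "i \<in> dom S" "(r', l) \<in> the (S i)" and j: "j \<in> dom S" "(r, l) \<in> the (S j)"
        unfolding cell by auto
      have "j \<le> i" using col[OF j(1) i(1) j(2) i(2)] * by simp
      also have "i \<le> Suc k" using row[OF i(1) k i(2) *(1)] * by simp
      finally show "(r, l) \<in> ?Y \<union> ?d"
        using j dom in_Y by (cases "j = Suc k") auto
    qed
    then obtain u where u: "?d = two_row_domino k (levels 0 us) u" by auto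
    have "S |` {1..Suc k} = (S |` {1..k})(Suc k \<mapsto> ?d)"
      using k by (auto simp: restrict_map_def fun_eq_iff)
    then have "S |` {1..Suc k} = std_tab (us @ [u])"
      using us u by (simp add: std_tab_snoc)
    then show ?case using us by (intro exI[of _ "us @ [u]"]) simp
  qed
  from this[of n] obtain us where "length us = n" "S |` {1..n} = std_tab us" by auto
  moreover have "S |` {1..n} = S"
    unfolding dom[symmetric] by (auto simp: restrict_map_def fun_eq_iff domIff)
  ultimately show ?thesis using that by simp
qed

section \<open>Signed permutations\<close>

definition window :: "nat \<Rightarrow> (int \<Rightarrow> int) \<Rightarrow> int list" where
  "window n w = map (\<lambda>i. w (int i)) [1..<Suc n]"

lemma length_window [simp]: "length (window n w) = n"
  by (simp add: window_def)

lemma nth_window: "i < n \<Longrightarrow> window n w ! i = w (int i + 1)"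
  by (simp add: window_def add.commute del: upt_Suc)

lemma take_window: "k \<le> n \<Longrightarrow> take k (window n w) = window k w"
  by (simp add: window_def take_map del: upt_Suc)

lemma insert_prefix_eq: "insert_prefix w k = insert_all (window k w)"
  by (simp add: insert_prefix_def insert_all_def window_def)

lemma signed_letters_window:
  assumes w: "w \<in> W n" and "k \<le> n" shows "signed_letters (window k w)"
  unfolding signed_letters_def
proof
  show "0 \<notin> set (window k w)"
    using W_nonzero[OF w] by (auto simp: window_def simp del: upt_Suc)
  show "distinct (map abs (window k w))"
    using W_abs_eq_iff[OF w] by (auto simp: window_def distinct_map inj_on_def simp del: upt_Suc)
qed

lemma labels_window:
  assumes w: "w \<in> W n" shows "(\<lambda>x. nat \<bar>x\<bar>) ` set (window n w) = {1..n}"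
proof (rule card_seteq)
  have "nat \<bar>x\<bar> \<in> {1..n}" if x: "x \<in> set (window n w)" for x
  proof -
    have "set (window n w) = (\<lambda>i. w (int i)) ` {1..n}"
      by (simp add: window_def atLeastLessThanSuc_atLeastAtMost del: upt_Suc)
    then obtain i where "i \<in> {1..n}" "x = w (int i)" using x by blast
    then have "x \<in> I_set n" using W_in_I_set[OF w, of "int i"] by (simp add: I_set_def)
    then show ?thesis by (auto simp: I_set_def)
  qed
  then show "(\<lambda>x. nat \<bar>x\<bar>) ` set (window n w) \<subseteq> {1..n}" by blast
  have "distinct (map (\<lambda>x. nat \<bar>x\<bar>) (window n w))"
    using signed_letters_window[OF w order_refl]
    by (auto simp: signed_letters_def distinct_map inj_on_def)
  then show "card {1..n} \<le> card ((\<lambda>x. nat \<bar>x\<bar>) ` set (window n w))"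
    using distinct_card[of "map (\<lambda>x. nat \<bar>x\<bar>) (window n w)"] by simp
qed simp

lemma has_321_window: "has_321 n w \<longleftrightarrow> word_321 (window n w)"
proof -
  have "(\<exists>i j. 1 \<le> i \<and> i < j \<and> j \<le> int n \<and> \<bar>w i\<bar> < - w j) \<longleftrightarrow>
    (\<exists>i j. i < j \<and> j < n \<and> \<bar>window n w ! i\<bar> < - window n w ! j)" (is "?l \<longleftrightarrow> ?r")
  proof
    assume ?l
    then obtain i j where "1 \<le> i" "i < j" "j \<le> int n" "\<bar>w i\<bar> < - w j" by blast
    then show ?r
      by (intro exI[of _ "nat (i - 1)"] exI[of _ "nat (j - 1)"]) (auto simp: nth_window)
  next
    assume ?r
    then obtain i j where "i < j" "j < n" "\<bar>window n w ! i\<bar> < - window n w ! j" by blast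
    then show ?l
      by (intro exI[of _ "int i + 1"] exI[of _ "int j + 1"]) (auto simp: nth_window)
  qed
  moreover have "(\<exists>i j l. 1 \<le> i \<and> i < j \<and> j < l \<and> l \<le> int n \<and> w j < \<bar>w i\<bar> \<and> \<bar>w l\<bar> < w j) \<longleftrightarrow>
    (\<exists>i j l. i < j \<and> j < l \<and> l < n \<and> window n w ! j < \<bar>window n w ! i\<bar> \<and> \<bar>window n w ! l\<bar> < window n w ! j)"
    (is "?l \<longleftrightarrow> ?r")
  proof
    assume ?l
    then obtain i j l where "1 \<le> i" "i < j" "j < l" "l \<le> int n" "w j < \<bar>w i\<bar>" "\<bar>w l\<bar> < w j" by blast
    then show ?r
      by (intro exI[of _ "nat (i - 1)"] exI[of _ "nat (j - 1)"] exI[of _ "nat (l - 1)"]) (auto simp: nth_window)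
  next
    assume ?r
    then obtain i j l where "i < j" "j < l" "l < n" "window n w ! j < \<bar>window n w ! i\<bar>"
      "\<bar>window n w ! l\<bar> < window n w ! j" by blast
    then show ?l
      by (intro exI[of _ "int i + 1"] exI[of _ "int j + 1"] exI[of _ "int l + 1"]) (auto simp: nth_window)
  qed
  ultimately show ?thesis
    unfolding has_321_def word_321_def length_window by (rule arg_cong2[where f = "(\<or>)"])
qed

lemma W_b_iff_runnable: "w \<in> W n \<Longrightarrow> w \<in> W_b n \<longleftrightarrow> runnable (window n w)"
  using W_b_iff_not_has_321 has_321_window runnable_iff signed_letters_window by blast

lemma runnable_window: "runnable (window n w) \<Longrightarrow> k \<le> n \<Longrightarrow> runnable (window k w)"
  unfolding runnable_def by (metis append.assoc append_Cons append_take_drop_id take_window)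

lemma run_window_length: "w \<in> W n \<Longrightarrow> k \<le> n \<Longrightarrow> length (run (window k w)) = k"
  using length_run[OF signed_letters_window] by simp

lemma run_window_sorted:
  "w \<in> W n \<Longrightarrow> k \<le> n \<Longrightarrow> sorted_labels (run (window k w))"
  using run_labels[OF signed_letters_window] by blast

lemma run_window_zip:
  assumes "w \<in> W n"
  shows "tab (run (window n w)) = std_tab (map snd (run (window n w)))"
    "run (window n w) = zip [1..<Suc n] (map snd (run (window n w)))"
proof -
  have "fst ` set (run (window n w)) = {1..n}"
    using run_labels[OF signed_letters_window[OF assms order_refl]] labels_window[OF assms] by simp
  from std_tab_eqI[OF run_window_sorted[OF assms order_refl] this]
  show "tab (run (window n w)) = std_tab (map snd (run (window n w)))"
    "run (window n w) = zip [1..<Suc n] (map snd (run (window n w)))" by blast+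
qed

lemma shape_insert_prefix:
  assumes "w \<in> W n" "runnable (window n w)" "k \<le> n"
  shows "shape (insert_prefix w k) = two_rows k (run_level (window k w))"
  using insert_all_tab[OF signed_letters_window[OF assms(1,3)]] runnable_window[OF assms(2,3)]
    shape_tab[OF sorted_labels_distinct[OF run_window_sorted[OF assms(1,3)]]] run_window_length[OF assms(1,3)]
  by (simp add: insert_prefix_eq run_level_def)

lemma run_level_le: "w \<in> W n \<Longrightarrow> k \<le> n \<Longrightarrow> run_level (window k w) \<le> k"
  using levels_le[of 0 0 "map snd (run (window k w))"] run_window_length by (simp add: run_level_def)

lemma Sh_two_rows_iff:
  assumes w: "w \<in> W n"
  shows "at_most_two_rows (Sh n w) \<longleftrightarrow> runnable (window n w)"
proof
  assume "at_most_two_rows (Sh n w)"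
  then have "\<not> reaches_row_three (shape (insert_all (window n w)))"
    using at_most_two_rows_not_reaches_row_three by (simp add: Sh_def P_tab_def insert_prefix_eq)
  then show "runnable (window n w)"
    using insert_all_tab[OF signed_letters_window[OF w order_refl]] by blast
next
  assume "runnable (window n w)"
  then show "at_most_two_rows (Sh n w)"
    using shape_insert_prefix[OF w _ order_refl] run_level_le[OF w order_refl] at_most_two_rows_two_rows
    by (simp add: Sh_def P_tab_def)
qed

lemma P_tab_eq:
  assumes "w \<in> W n" "runnable (window n w)"
  shows "P_tab n w = std_tab (map snd (run (window n w)))"
  using insert_all_tab[OF signed_letters_window[OF assms(1) order_refl]] assms(2) run_window_zip(1)[OF assms(1)]
  by (simp add: P_tab_def insert_prefix_eq)

text \<open>Consecutive shapes are two-row diagrams whose levels are related by \<open>lev\<close>,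
  so their difference is the domino selected by the corresponding letter of
  \<open>recording\<close>.\<close>

lemma Q_tab_eq:
  assumes w: "w \<in> W n" and r: "runnable (window n w)"
  shows "Q_tab n w = std_tab (recording (window n w))"
proof
  fix k
  show "Q_tab n w k = std_tab (recording (window n w)) k"
  proof (cases "k \<in> {1..n}")
    case False
    then have "k \<notin> dom (std_tab (recording (window n w)))" by (simp add: dom_std_tab)
    then show ?thesis using False by (auto simp: Q_tab_def)
  next
    case True
    then obtain j where k: "k = Suc j" "j < n" by (cases k) auto
    define qs where "qs = recording (window n w)"
    have take: "take i qs = recording (window i w)" if "i \<le> n" for i
    proof -
      have "take i qs = map (\<lambda>k. run_level (take k (window n w)) < run_level (take (Suc k) (window n w))) [0..<i]"
        using that by (simp add: qs_def recording_def take_map)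
      also have "\<dots> = recording (window i w)"
        using that by (auto simp: recording_def take_window)
      finally show ?thesis .
    qed
    have lv: "levels 0 (take i qs) = run_level (window i w)" if "i \<le> n" for i
      using levels_recording[OF signed_letters_window[OF w that] runnable_window[OF r that]] take[OF that] by simp
    let ?m = "run_level (window j w)"
    have m: "?m \<le> j" using run_level_le[OF w] k by simp
    have "run_level (window k w) = lev ?m (qs ! j)"
      using lv[of k] lv[of j] k by (simp add: qs_def take_Suc_conv_app_nth)
    then have "shape (insert_prefix w k) - shape (insert_prefix w j) = two_row_domino j ?m (qs ! j)"
      using shape_insert_prefix[OF w r, of k] shape_insert_prefix[OF w r, of j] k
        two_rows_step[OF m, of "qs ! j"] two_row_domino_disjoint[OF m, of "qs ! j"]
      by auto
    moreover have "std_tab qs k = Some (two_row_domino j ?m (qs ! j))"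
      using std_tab_lookup[of j qs] lv[of j] k by (simp add: qs_def)
    ultimately show ?thesis using True k by (simp add: Q_tab_def qs_def)
  qed
qed

lemma exists_element:
  assumes s: "signed_letters ys" and labels: "(\<lambda>x. nat \<bar>x\<bar>) ` set ys = {1..n}" and len: "length ys = n"
  obtains w where "w \<in> W n" "window n w = ys"
proof -
  \<comment> \<open>The odd extension of the word, with 0 and everything beyond \<open>n\<close>
    fixed as \<open>permutes\<close> demands.\<close>
  define w where "w i = (if i \<in> I_set n then sgn i * ys ! nat (\<bar>i\<bar> - 1) else i)" for i
  have abs: "\<bar>w i\<bar> = \<bar>ys ! nat (\<bar>i\<bar> - 1)\<bar>" and idx: "nat (\<bar>i\<bar> - 1) < length ys" if "i \<in> I_set n" for i
    using that len by (auto simp: w_def abs_mult I_set_def abs_sgn_eq)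
  have in_I: "w i \<in> I_set n" if "i \<in> I_set n" for i
  proof -
    have "nat \<bar>w i\<bar> \<in> {1..n}"
      unfolding abs[OF that] labels[symmetric] using idx[OF that] by auto
    then show ?thesis by (auto simp: I_set_def)
  qed
  have odd: "w (- i) = - w i" for i
    by (auto simp: w_def I_set_def sgn_if)
  have nz: "ys ! k \<noteq> 0" if "k < length ys" for k
    using s that by (auto simp: signed_letters_def in_set_conv_nth)
  have "inj_on w (I_set n)"
  proof (rule inj_onI)
    fix i j assume ij: "i \<in> I_set n" "j \<in> I_set n" "w i = w j"
    then have "map abs ys ! nat (\<bar>i\<bar> - 1) = map abs ys ! nat (\<bar>j\<bar> - 1)"
      using abs[OF ij(1)] abs[OF ij(2)] idx[OF ij(1)] idx[OF ij(2)] by simp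
    then have "nat (\<bar>i\<bar> - 1) = nat (\<bar>j\<bar> - 1)"
      using s idx[OF ij(1)] idx[OF ij(2)] by (subst (asm) nth_eq_iff_index_eq) (auto simp: signed_letters_def)
    then have eq: "\<bar>i\<bar> = \<bar>j\<bar>" using ij by (auto simp: I_set_def)
    then have "sgn i = sgn j" using ij nz[OF idx[OF ij(2)]] by (simp add: w_def)
    with eq show "i = j" by (metis abs_mult_sgn mult.commute sgn_mult_abs)
  qed
  moreover have "w ` I_set n \<subseteq> I_set n" using in_I by blast
  moreover have "finite (I_set n)" by (simp add: I_set_def)
  ultimately have "bij_betw w (I_set n) (I_set n)"
    by (simp add: bij_betw_def endo_inj_surj)
  then have "w permutes I_set n" by (rule bij_imp_permutes) (simp add: w_def)
  then have W: "w \<in> W n" using odd by (simp add: W_def)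
  have "window n w = ys"
    by (rule nth_equalityI) (auto simp: len nth_window w_def I_set_def)
  with W that show ?thesis by blast
qed

lemma window_inj:
  assumes v: "v \<in> W n" and w: "w \<in> W n" and eq: "window n v = window n w"
  shows "v = w"
proof
  fix p
  have pos: "v p = w p" if "1 \<le> p" "p \<le> int n" for p
    using arg_cong[OF eq, of "\<lambda>ys. ys ! nat (p - 1)"] that by (auto simp: nth_window)
  consider "1 \<le> p" "p \<le> int n" | "1 \<le> - p" "- p \<le> int n" | "p \<notin> I_set n"
    by (cases "p \<in> I_set n"; cases "p \<ge> 1") (auto simp: I_set_def)
  then show "v p = w p"
  proof cases
    case 2 then show ?thesis using pos[of "- p"] W_minus[OF v, of p] W_minus[OF w, of p] by simp
  next
    case 3 then show ?thesis using v w by (simp add: W_def permutes_def)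
  qed (simp add: pos)
qed

theorem theorem2p10:
  fixes n :: nat
  assumes "n \<ge> 1"
  shows "(\<forall>w\<in>W n. w \<in> W_b n \<longleftrightarrow> at_most_two_rows (Sh n w)) \<and>
    bij_betw (\<lambda>w. (P_tab n w, Q_tab n w)) (W_b n)
      {(S, T). standard_domino_tableau n S \<and> standard_domino_tableau n T \<and>
               shape S = shape T \<and> at_most_two_rows (shape S)}"
proof (intro conjI ballI)
  show "w \<in> W_b n \<longleftrightarrow> at_most_two_rows (Sh n w)" if "w \<in> W n" for w
    using W_b_iff_runnable Sh_two_rows_iff that by blast
  have W_b: "w \<in> W n" "runnable (window n w)" if "w \<in> W_b n" for w
    using that W_b_iff_runnable by (auto simp: W_b_def)
  have run_length: "length (map snd (run (window n w))) = n" if "w \<in> W_b n" for w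
    using run_window_length[OF W_b(1)[OF that]] by simp
  let ?R = "{(S, T). standard_domino_tableau n S \<and> standard_domino_tableau n T \<and>
               shape S = shape T \<and> at_most_two_rows (shape S)}"
  show "bij_betw (\<lambda>w. (P_tab n w, Q_tab n w)) (W_b n) ?R"
    unfolding bij_betw_def
  proof
    show "inj_on (\<lambda>w. (P_tab n w, Q_tab n w)) (W_b n)"
    proof (rule inj_onI)
      fix v w assume v: "v \<in> W_b n" and w: "w \<in> W_b n"
        and "(P_tab n v, Q_tab n v) = (P_tab n w, Q_tab n w)"
      then have "map snd (run (window n v)) = map snd (run (window n w))"
        "recording (window n v) = recording (window n w)"
        using P_tab_eq W_b Q_tab_eq std_tab_inj by (metis prod.inject)+
      \<comment> \<open>Both encoded words carry the labels 1 to \<open>n\<close>, so their letters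
        alone determine them.\<close>
      moreover from this have "run (window n v) = run (window n w)"
        using run_window_zip(2)[OF W_b(1)[OF v]] run_window_zip(2)[OF W_b(1)[OF w]] by metis
      ultimately have "window n v = window n w"
        using v w W_b signed_letters_window[of _ n n] by (intro run_recording_inj) auto
      then show "v = w" using window_inj W_b v w by blast
    qed
    show "(\<lambda>w. (P_tab n w, Q_tab n w)) ` W_b n = ?R"
    proof (intro equalityI subsetI)
      fix ST assume "ST \<in> (\<lambda>w. (P_tab n w, Q_tab n w)) ` W_b n"
      then obtain w where w: "w \<in> W_b n" "ST = (P_tab n w, Q_tab n w)" by blast
      have lv: "levels 0 (recording (window n w)) = run_level (window n w)"
        using levels_recording W_b w(1) signed_letters_window[of w n n] by blast
      have "shape (P_tab n w) = two_rows n (run_level (window n w))"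
        "shape (Q_tab n w) = two_rows n (run_level (window n w))"
        using w(1) W_b run_length by (simp_all add: P_tab_eq Q_tab_eq shape_std_tab lv) (simp add: run_level_def)
      then show "ST \<in> ?R"
        using w W_b run_length standard_std_tab[OF run_length] standard_std_tab[of "recording (window n w)" n]
          at_most_two_rows_two_rows[OF run_level_le[of w n n]]
        by (simp add: P_tab_eq Q_tab_eq)
    next
      fix ST assume "ST \<in> ?R"
      then obtain S T where ST: "ST = (S, T)" "standard_domino_tableau n S" "standard_domino_tableau n T"
        "shape S = shape T" "at_most_two_rows (shape S)" by blast
      obtain us where us: "length us = n" "S = std_tab us" using standard_two_rows ST by metis
      obtain qs where qs: "length qs = n" "T = std_tab qs" using standard_two_rows ST by metis
      \<comment> \<open>Equality of the shapes is equality of the final levels, which is the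
        compatibility that \<open>exists_run\<close> asks of the two words.\<close>
      have lv: "levels 0 qs = levels 0 us"
        using two_rows_inj[of "levels 0 qs" n "levels 0 us"] ST(4) us qs levels_le[of 0 0 us] levels_le[of 0 0 qs]
        by (simp add: shape_std_tab)
      let ?L = "zip [1..<Suc n] us"
      have L: "sorted_labels ?L" "map fst ?L = [1..<Suc n]" "map snd ?L = us" "length ?L = n"
        using sorted_labels_zip[of us] us by (simp_all del: upt_Suc)
      then have labels: "fst ` set ?L = {1..n}"
        by (metis atLeastLessThanSuc_atLeastAtMost set_map set_upt)
      obtain ys where ys: "signed_letters ys" "runnable ys" "run ys = ?L" "recording ys = qs"
        using exists_run[of ?L qs] L labels qs lv by auto
      have "(\<lambda>x. nat \<bar>x\<bar>) ` set ys = {1..n}" using run_labels[OF ys(1)] ys(3) labels by simp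
      moreover have "length ys = n" using length_run[OF ys(1)] ys(3) L(4) by simp
      ultimately obtain w where w: "w \<in> W n" "window n w = ys" using exists_element ys(1) by blast
      then have "w \<in> W_b n" using W_b_iff_runnable ys(2) by blast
      moreover have "(P_tab n w, Q_tab n w) = ST"
        using P_tab_eq[OF w(1)] Q_tab_eq[OF w(1)] w ys L us qs ST by simp
      ultimately show "ST \<in> (\<lambda>w. (P_tab n w, Q_tab n w)) ` W_b n" by blast
    qed
  qed
qed

end
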